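(* Let $A$ be a finite alphabet with $|A|\geq 2$ and let $\sigma\colon A^*\to A^*$ be a primitive episturmian morphism. Then there is a letter $a_{\min}\in A$, namely the minimal letter of $\sigma$ (the unique letter such that $|\sigma(a_{\min})|<|\sigma(a)|$ for every $a\in A$, $a\neq a_{\min}$), such that: (i) if $\operatorname{ind}(\sigma)\geq|\sigma(a_{\min})|$, then $\sigma$ fails the return preservation property for all but finitely many words in $\{a_{\min}L_n \mid n\in\mathbb{N},\ L_n=R_n\}$, i.e. $\sigma(\mathcal{R}_\sigma(u))\neq\mathcal{R}_\sigma(\sigma(u))$ for all but finitely many $u$ in this set; (ii) if $\operatorname{ind}(\sigma)\leq\frac{\Vert\sigma\Vert-|A|}{|A|-1}-|\sigma(a_{\min})|$, then $\sigma$ fails the return preservation property for all but finitely many words in $\{R_na_{\min}\mid n\in\mathbb{N},\ L_n=R_n\}$, i.e. $\sigma(\mathcal{R}_\sigma(u))\neq\mathcal{R}_\sigma(\sigma(u))$ for all but finitely many $u$ in this set.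
   Context: $A^*$ is the free monoid of finite words over $A$ with empty word $\varepsilon$, $A^+=A^*\setminus\{\varepsilon\}$, $|u|$ is the length of $u$, and $\Vert\sigma\Vert=\sum_{a\in A}|\sigma(a)|$. Episturmian morphisms. For $a\in A$ let $\psi_a,\bar\psi_a\colon A^*\to A^*$ be the morphisms with $\psi_a(a)=\bar\psi_a(a)=a$ and $\psi_a(b)=ab$, $\bar\psi_a(b)=ba$ for $b\neq a$. Permutations of $A$ are viewed as automorphisms of $A^*$. The episturmian morphisms over $A$ are the elements of the monoid (under composition) generated by all $\psi_a$, $\bar\psi_a$ ($a\in A$) and all permutations of $A$; the standard (episturmian) morphisms are the elements of the submonoid generated by all $\psi_a$ ($a\in A$) and all permutations. Conjugacy index. For morphisms $\sigma,\rho$ and $w\in A^*$, write $\sigma=w\rho w^{-1}$ (equivalently $\rho=w^{-1}\sigma w$) if $\sigma(a)w=w\rho(a)$ for all $a\in A$; then $\rho$ is called a right conjugate of $\sigma$. Every episturmian morphism $\sigma$ is a right conjugate of a unique standard morphism (known result), and $\operatorname{ind}(\sigma)$ is the length of the unique word $w$ such that $w\sigma w^{-1}$ is standard. Primitive means: there is $k\geq1$ such that every letter of $A$ occurs in $\sigma^k(a)$ for every $a\in A$. A primitive morphism has a periodic point $\mathbf{x}\in A^{\mathbb{N}}$ (i.e. $\sigma^k(\mathbf{x})=\mathbf{x}$ for some $k\ge1$); $X_\sigma\subseteq A^{\mathbb{N}}$ is the closure of the orbit of $\mathbf{x}$ under the shift map (independent of the choice of $\mathbf{x}$), and $\mathcal{L}(\sigma)$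 is the set of finite words occurring as factors in elements of $X_\sigma$. A word $v\in\mathcal{L}(\sigma)$ is left special if there are at least two letters $a$ with $av\in\mathcal{L}(\sigma)$, and right special if there are at least two letters $a$ with $va\in\mathcal{L}(\sigma)$. For $\sigma$ primitive episturmian, $\mathcal{L}(\sigma)$ contains for every $n\in\mathbb{N}$ exactly one left special word $L_n$ and exactly one right special word $R_n$ of length $n$. Return sets. For $u\in\mathcal{L}(\sigma)$, $\mathcal{R}_\sigma(u)=\{r\in A^*\mid ru\in(\mathcal{L}(\sigma)\cap uA^+)\setminus A^+uA^+\}$. The morphism $\sigma$ satisfies the return preservation property for $u\in\mathcal{L}(\sigma)$ if $\sigma(\mathcal{R}_\sigma(u))=\mathcal{R}_\sigma(\sigma(u))$, and fails it for $u$ otherwise. *)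

theory Defs
  imports "HOL-Analysis.Analysis" "HOL-Library.Omega_Words_Fun"
begin

text \<open>The alphabet is a finite type, finite words over it are lists, infinite words are functions
  on the natural numbers.  A morphism of the free monoid is a function on lists; its value on a
  letter \<open>a\<close> is \<open>\<sigma> [a]\<close>.  Being a monoid morphism is not stated separately: it holds for every
  element of \<open>episturmian\<close>.\<close>

definition psi :: "'a \<Rightarrow> 'a list \<Rightarrow> 'a list" where
  "psi a w = concat (map (\<lambda>b. if b = a then [a] else [a, b]) w)"

definition psi_bar :: "'a \<Rightarrow> 'a list \<Rightarrow> 'a list" where
  "psi_bar a w = concat (map (\<lambda>b. if b = a then [a] else [b, a]) w)"

inductive_set episturmian :: "('a list \<Rightarrow> 'a list) set" where
  id: "id \<in> episturmian"
| psi: "psi a \<in> episturmian"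
| psi_bar: "psi_bar a \<in> episturmian"
| perm: "bij \<pi> \<Longrightarrow> map \<pi> \<in> episturmian"
| comp: "\<sigma> \<in> episturmian \<Longrightarrow> \<tau> \<in> episturmian \<Longrightarrow> \<sigma> \<circ> \<tau> \<in> episturmian"

inductive_set standard_episturmian :: "('a list \<Rightarrow> 'a list) set" where
  id: "id \<in> standard_episturmian"
| psi: "psi a \<in> standard_episturmian"
| perm: "bij \<pi> \<Longrightarrow> map \<pi> \<in> standard_episturmian"
| comp: "\<sigma> \<in> standard_episturmian \<Longrightarrow> \<tau> \<in> standard_episturmian \<Longrightarrow>
    \<sigma> \<circ> \<tau> \<in> standard_episturmian"

text \<open>\<open>conjugate_by \<sigma> w \<rho>\<close> means \<open>\<sigma> = w \<rho> w\<^sup>-\<^sup>1\<close>, so \<open>\<rho>\<close> is a right conjugate of \<open>\<sigma>\<close>.\<close>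

definition conjugate_by :: "('a list \<Rightarrow> 'a list) \<Rightarrow> 'a list \<Rightarrow> ('a list \<Rightarrow> 'a list) \<Rightarrow> bool" where
  "conjugate_by \<sigma> w \<rho> \<longleftrightarrow> (\<forall>a. \<sigma> [a] @ w = w @ \<rho> [a])"

definition ind :: "('a list \<Rightarrow> 'a list) \<Rightarrow> nat" where
  "ind \<sigma> = length (THE w. \<exists>\<tau>\<in>standard_episturmian. conjugate_by \<tau> w \<sigma>)"

definition total_length :: "('a::finite list \<Rightarrow> 'a list) \<Rightarrow> nat" where
  "total_length \<sigma> = (\<Sum>a\<in>UNIV. length (\<sigma> [a]))"

definition primitive_morphism :: "('a list \<Rightarrow> 'a list) \<Rightarrow> bool" where
  "primitive_morphism \<sigma> \<longleftrightarrow> (\<exists>k\<ge>1. \<forall>a b. b \<in> set ((\<sigma> ^^ k) [a]))"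

definition minimal_letter :: "('a list \<Rightarrow> 'a list) \<Rightarrow> 'a \<Rightarrow> bool" where
  "minimal_letter \<sigma> a \<longleftrightarrow> (\<forall>b. b \<noteq> a \<longrightarrow> length (\<sigma> [a]) < length (\<sigma> [b]))"

text \<open>The action of a morphism on infinite words.  It is meant for non-erasing morphisms
  (primitive ones are), for which the image of the prefix of length \<open>n + 1\<close> has a letter at
  position \<open>n\<close>.\<close>

definition inf_image :: "('a list \<Rightarrow> 'a list) \<Rightarrow> (nat \<Rightarrow> 'a) \<Rightarrow> (nat \<Rightarrow> 'a)" where
  "inf_image \<sigma> x = (\<lambda>n. \<sigma> (map x [0..<Suc n]) ! n)"

definition periodic_point :: "('a list \<Rightarrow> 'a list) \<Rightarrow> (nat \<Rightarrow> 'a) \<Rightarrow> bool" where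
  "periodic_point \<sigma> x \<longleftrightarrow> (\<exists>k\<ge>1. inf_image (\<sigma> ^^ k) x = x)"

text \<open>The periodic point is an arbitrary one; for primitive \<open>\<sigma>\<close> one exists and the shift does
  not depend on the choice.\<close>

definition shift_space :: "('a list \<Rightarrow> 'a list) \<Rightarrow> (nat \<Rightarrow> 'a) set" where
  "shift_space \<sigma> =
    product_topology (\<lambda>_. discrete_topology UNIV) UNIV closure_of
      range (\<lambda>n. suffix n (SOME x. periodic_point \<sigma> x))"

definition language :: "('a list \<Rightarrow> 'a list) \<Rightarrow> 'a list set" where
  "language \<sigma> = {map y [i..<j] | y i j. y \<in> shift_space \<sigma>}"

definition left_special :: "('a list \<Rightarrow> 'a list) \<Rightarrow> 'a list \<Rightarrow> bool" where
  "left_special \<sigma> v \<longleftrightarrow> v \<in> language \<sigma> \<and>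
    (\<exists>a b. a \<noteq> b \<and> a # v \<in> language \<sigma> \<and> b # v \<in> language \<sigma>)"

definition right_special :: "('a list \<Rightarrow> 'a list) \<Rightarrow> 'a list \<Rightarrow> bool" where
  "right_special \<sigma> v \<longleftrightarrow> v \<in> language \<sigma> \<and>
    (\<exists>a b. a \<noteq> b \<and> v @ [a] \<in> language \<sigma> \<and> v @ [b] \<in> language \<sigma>)"

text \<open>For primitive episturmian \<open>\<sigma>\<close> the words described below exist and are unique.\<close>

definition left_special_word :: "('a list \<Rightarrow> 'a list) \<Rightarrow> nat \<Rightarrow> 'a list" where
  "left_special_word \<sigma> n = (THE v. left_special \<sigma> v \<and> length v = n)"

definition right_special_word :: "('a list \<Rightarrow> 'a list) \<Rightarrow> nat \<Rightarrow> 'a list" where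
  "right_special_word \<sigma> n = (THE v. right_special \<sigma> v \<and> length v = n)"

definition return_set :: "('a list \<Rightarrow> 'a list) \<Rightarrow> 'a list \<Rightarrow> 'a list set" where
  "return_set \<sigma> u =
    {r. r @ u \<in> (language \<sigma> \<inter> {u @ s | s. s \<noteq> []}) - {p @ u @ s | p s. p \<noteq> [] \<and> s \<noteq> []}}"

definition return_preserving :: "('a list \<Rightarrow> 'a list) \<Rightarrow> 'a list \<Rightarrow> bool" where
  "return_preserving \<sigma> u \<longleftrightarrow> \<sigma> ` return_set \<sigma> u = return_set \<sigma> (\<sigma> u)"

end

theory Submission
  imports Defs "HOL-Library.Sublist"
begin

text \<open>
  Every episturmian morphism \<open>\<sigma>\<close> lies between two extreme conjugates: there are words \<open>w\<close>, \<open>q\<close>,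
  a standard morphism \<open>\<tau>\<close> and a morphism \<open>\<theta>\<close> with \<open>\<tau> u @ w = w @ \<sigma> u\<close> and
  \<open>\<sigma> u @ q = q @ \<theta> u\<close> for all \<open>u\<close>.  The images of the letters under \<open>\<tau>\<close> end with different
  letters.  Hence \<open>\<sigma>\<close> is injective and \<open>w\<close> is determined by \<open>\<sigma>\<close>, so that
  \<open>ind \<sigma> = length w\<close> (\<open>ind_eq_length\<close>).  Counting letters gives
  \<open>total_length \<sigma> = (CARD('a) - 1) * length (w @ q) + CARD('a)\<close>.  The hypotheses of the two parts
  therefore say that \<open>\<sigma> [a]\<close> is not longer than \<open>w\<close>, respectively not longer than \<open>q\<close>.  Then
  \<open>\<sigma> [a]\<close> is a suffix of \<open>w\<close>, respectively a prefix of \<open>q\<close>.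

  For the first part let \<open>B\<close> be left special and choose a letter \<open>b \<noteq> a\<close> for which \<open>b # B\<close> is a
  factor.  By recurrence there is a factor \<open>v @ B\<close> that begins with \<open>B\<close> and in which \<open>v\<close> ends with
  \<open>b\<close>.  Whatever stands before \<open>v\<close>, the image of a long word ends with \<open>w\<close> and so with
  \<open>\<sigma> [a]\<close>.  Thus \<open>\<sigma> [a] @ \<sigma> v @ \<sigma> B\<close> is a factor, and it begins and ends with
  \<open>\<sigma> (a # B)\<close>.  The word leading from the first of these occurrences to the last is a product of
  return words of \<open>\<sigma> (a # B)\<close>.  If \<open>\<sigma>\<close> preserved the return words of \<open>a # B\<close>, this product
  would be \<open>\<sigma> r\<close> for some \<open>r\<close> (\<open>return_preserving_lift\<close>), which means
  \<open>\<sigma> (a # v) = \<sigma> (r @ [a])\<close>.  By injectivity \<open>v\<close> would end with \<open>a\<close>, a contradiction.  The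
  second part is the mirror image, with \<open>q\<close> in place of \<open>w\<close>.  Both sets in the theorem are thus
  empty.

  What remains is the background: the language consists of the factors of the iterates of \<open>\<sigma>\<close> on
  letters and is recurrent, some letter is minimal, and there is exactly one left and one right
  special word of each length.  Special words exist because \<open>v \<mapsto> w @ \<sigma> v @ q\<close> turns a word
  that all letters extend to the left into a longer one.  They are unique because \<open>\<sigma>\<close> can be written as \<open>\<mu> \<circ> \<rho>\<close> with an
  elementary morphism \<open>\<mu>\<close>, and undoing \<open>\<mu>\<close> maps two left special words of \<open>\<sigma>\<close> to shorter ones
  of \<open>\<rho> \<circ> \<mu>\<close>.
\<close>

section \<open>Non-erasing morphisms and factors of their iterates\<close>

locale nonerasing_morphism =
  fixes \<sigma> :: "'a list \<Rightarrow> 'a list"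
  assumes append: "\<sigma> (u @ v) = \<sigma> u @ \<sigma> v"
    and nonempty: "\<sigma> [c] \<noteq> []"
begin

lemma image_Nil: "\<sigma> [] = []"
  using append[of "[]" "[]"] by simp

lemma image_Cons: "\<sigma> (c # u) = \<sigma> [c] @ \<sigma> u"
  using append[of "[c]" u] by simp

lemma length_le: "length u \<le> length (\<sigma> u)"
proof (induction u)
  case (Cons c u)
  have "length (\<sigma> [c]) \<ge> 1" using nonempty[of c] by (simp add: Suc_leI)
  then show ?case using Cons.IH by (subst image_Cons) simp
qed simp

lemma eq_Nil_iff: "\<sigma> u = [] \<longleftrightarrow> u = []"
  using length_le[of u] image_Nil by auto

lemma sublist_image: "sublist u v \<Longrightarrow> sublist (\<sigma> u) (\<sigma> v)"
  unfolding sublist_def using append by (elim exE) auto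

lemma set_image_mono: "c \<in> set u \<Longrightarrow> set (\<sigma> [c]) \<subseteq> set (\<sigma> u)"
proof -
  assume "c \<in> set u"
  then have "sublist [c] u" by (auto simp: in_set_conv_decomp sublist_def)
  then show ?thesis by (rule set_mono_sublist[OF sublist_image])
qed

end

lemma count_list_image:
  fixes \<sigma> :: "'a::finite list \<Rightarrow> 'a list"
  assumes "nonerasing_morphism \<sigma>"
  shows "count_list (\<sigma> u) d = (\<Sum>c\<in>UNIV. count_list u c * count_list (\<sigma> [c]) d)"
proof (induction u)
  case Nil
  show ?case using nonerasing_morphism.image_Nil[OF assms] by simp
next
  case (Cons x u)
  have "(\<Sum>c\<in>UNIV. count_list (x # u) c * count_list (\<sigma> [c]) d)
      = (\<Sum>c\<in>UNIV. (if c = x then count_list (\<sigma> [c]) d else 0) + count_list u c * count_list (\<sigma> [c]) d)"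
    by (rule sum.cong) auto
  also have "\<dots> = count_list (\<sigma> [x]) d + count_list (\<sigma> u) d"
    using Cons by (simp add: sum.distrib)
  finally show ?case by (subst nonerasing_morphism.image_Cons[OF assms]) simp
qed

lemma nonerasing_morphism_comp:
  "nonerasing_morphism \<sigma> \<Longrightarrow> nonerasing_morphism \<tau> \<Longrightarrow> nonerasing_morphism (\<sigma> \<circ> \<tau>)"
  by unfold_locales
    (simp_all add: nonerasing_morphism.append nonerasing_morphism.eq_Nil_iff nonerasing_morphism.nonempty)

lemma nonerasing_morphism_funpow:
  "nonerasing_morphism \<sigma> \<Longrightarrow> nonerasing_morphism (\<sigma> ^^ m)"
proof (induction m)
  case 0
  show ?case by unfold_locales auto
next
  case (Suc m)
  then show ?case by (simp add: nonerasing_morphism_comp del: o_apply)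
qed

text \<open>For a primitive morphism this turns out to be the language of the shift space, in a form that does
  not refer to a periodic point.\<close>

definition iterate_factors :: "('a list \<Rightarrow> 'a list) \<Rightarrow> 'a list set" where
  "iterate_factors \<sigma> = {v. \<exists>m c. sublist v ((\<sigma> ^^ m) [c])}"

lemma iterate_factorsI: "sublist v ((\<sigma> ^^ m) [c]) \<Longrightarrow> v \<in> iterate_factors \<sigma>"
  by (auto simp: iterate_factors_def)

lemma iterate_factors_sublist:
  "v \<in> iterate_factors \<sigma> \<Longrightarrow> sublist u v \<Longrightarrow> u \<in> iterate_factors \<sigma>"
  unfolding iterate_factors_def by (blast intro: sublist_order.order.trans)

lemma iterate_factors_letter: "[c] \<in> iterate_factors \<sigma>"
  by (rule iterate_factorsI[of _ 0 _ c]) simp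

locale primitive_nonerasing = nonerasing_morphism \<sigma>
  for \<sigma> :: "'a::finite list \<Rightarrow> 'a list" +
  assumes primitive: "primitive_morphism \<sigma>"
    and two_letters: "CARD('a) \<ge> 2"
begin

lemma nonerasing_pow: "nonerasing_morphism (\<sigma> ^^ m)"
  by (rule nonerasing_morphism_funpow) unfold_locales

lemmas pow_append = nonerasing_morphism.append[OF nonerasing_pow]

lemma other_letter: "\<exists>b::'a. b \<noteq> a"
proof (rule ccontr)
  assume "\<nexists>b. b \<noteq> a"
  then have "(UNIV :: 'a set) = {a}" by auto
  then have "CARD('a) = card {a}" by (rule arg_cong)
  then show False using two_letters by simp
qed

lemma image_iterate_factors:
  assumes "v \<in> iterate_factors \<sigma>" shows "\<sigma> v \<in> iterate_factors \<sigma>"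
proof -
  obtain m c where "sublist v ((\<sigma> ^^ m) [c])"
    using assms by (auto simp: iterate_factors_def)
  then have "sublist (\<sigma> v) ((\<sigma> ^^ Suc m) [c])" using sublist_image by simp
  then show ?thesis by (rule iterate_factorsI)
qed

lemma pow_iterate_factors:
  "v \<in> iterate_factors \<sigma> \<Longrightarrow> (\<sigma> ^^ m) v \<in> iterate_factors \<sigma>"
  by (induction m) (auto simp: image_iterate_factors)

lemma eventually_all_letters: "\<exists>k. \<forall>M\<ge>k. \<forall>c d. d \<in> set ((\<sigma> ^^ M) [c])"
proof -
  obtain k where k: "\<And>a b. b \<in> set ((\<sigma> ^^ k) [a])"
    using primitive by (auto simp: primitive_morphism_def)
  have "d \<in> set ((\<sigma> ^^ M) [c])" if "M \<ge> k" for M c d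
  proof -
    obtain j where j: "M = k + j" using \<open>M \<ge> k\<close> by (auto simp: le_iff_add)
    obtain e where e: "e \<in> set ((\<sigma> ^^ j) [c])"
      using nonerasing_morphism.nonempty[OF nonerasing_pow, of j c] last_in_set by blast
    have "d \<in> set ((\<sigma> ^^ k) ((\<sigma> ^^ j) [c]))"
      using nonerasing_morphism.set_image_mono[OF nonerasing_pow[of k] e] k by blast
    then show ?thesis by (simp add: j funpow_add)
  qed
  then show ?thesis by (intro exI[of _ k]) simp
qed

lemma eventually_long: "\<exists>k. \<forall>M\<ge>k. \<forall>c. length ((\<sigma> ^^ M) [c]) \<ge> N"
proof (induction N)
  case (Suc N)
  from Suc.IH obtain k where k: "\<forall>M\<ge>k. \<forall>c. length ((\<sigma> ^^ M) [c]) \<ge> N" ..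
  from eventually_all_letters obtain l
    where l: "\<forall>M\<ge>l. \<forall>c d. d \<in> set ((\<sigma> ^^ M) [c])" ..
  have "length ((\<sigma> ^^ M) [c]) \<ge> Suc N" if M: "M \<ge> k + l" for M c
  proof -
    obtain j where j: "M = k + j" "j \<ge> l" using M by (intro that[of "M - k"]) auto
    \<comment> \<open>\<open>(\<sigma> ^^ j) [c]\<close> contains two different letters, so \<open>\<sigma> ^^ k\<close> has one more letter to act on.\<close>
    obtain b where "b \<noteq> c" using other_letter by blast
    then have "b \<in> set ((\<sigma> ^^ j) [c])" "c \<in> set ((\<sigma> ^^ j) [c])" using l j by auto
    with \<open>b \<noteq> c\<close> obtain x y z where xyz: "(\<sigma> ^^ j) [c] = x # y # z"
      by (cases "(\<sigma> ^^ j) [c]"; cases "tl ((\<sigma> ^^ j) [c])") auto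
    have "(\<sigma> ^^ M) [c] = (\<sigma> ^^ k) ([x] @ y # z)" by (simp add: j funpow_add xyz)
    also have "\<dots> = (\<sigma> ^^ k) [x] @ (\<sigma> ^^ k) (y # z)" by (rule pow_append)
    finally have "length ((\<sigma> ^^ M) [c]) \<ge> N + length (y # z)"
      using k[rule_format, of k x] nonerasing_morphism.length_le[OF nonerasing_pow, of "y # z" k] by simp
    then show ?thesis by simp
  qed
  then show ?case by (intro exI[of _ "k + l"]) simp
qed simp

lemma eventually_factor:
  assumes "v \<in> iterate_factors \<sigma>"
  shows "\<exists>k. \<forall>M\<ge>k. \<forall>d. sublist v ((\<sigma> ^^ M) [d])"
proof -
  obtain m c where mc: "sublist v ((\<sigma> ^^ m) [c])"
    using assms by (auto simp: iterate_factors_def)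
  from eventually_all_letters obtain l
    where l: "\<forall>M\<ge>l. \<forall>c d. d \<in> set ((\<sigma> ^^ M) [c])" ..
  have "sublist v ((\<sigma> ^^ M) [d])" if M: "M \<ge> m + l" for M d
  proof -
    obtain j where j: "M = m + j" "j \<ge> l" using M by (intro that[of "M - m"]) auto
    have "sublist [c] ((\<sigma> ^^ j) [d])"
      using l[rule_format, OF j(2), of c d] by (auto simp: in_set_conv_decomp sublist_def)
    then have "sublist ((\<sigma> ^^ m) [c]) ((\<sigma> ^^ m) ((\<sigma> ^^ j) [d]))"
      by (rule nonerasing_morphism.sublist_image[OF nonerasing_pow])
    with mc have "sublist v ((\<sigma> ^^ m) ((\<sigma> ^^ j) [d]))" by (rule sublist_order.order.trans)
    then show ?thesis by (simp add: j funpow_add)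
  qed
  then show ?thesis by (intro exI[of _ "m + l"]) simp
qed

text \<open>Both factors occur in the \<open>M\<close>-th iterates of all letters once \<open>M\<close> is large, so they occur in
  this order in the \<open>M\<close>-th image of any two consecutive letters.  This is the recurrence of the
  language; the context of length \<open>N\<close> on either side serves to make the images of the surroundings
  long.\<close>

lemma iterate_factors_connect:
  assumes "u \<in> iterate_factors \<sigma>" "v \<in> iterate_factors \<sigma>"
  shows "\<exists>x t y. length x \<ge> N \<and> length y \<ge> N \<and> x @ u @ t @ v @ y \<in> iterate_factors \<sigma>"
proof -
  from eventually_factor[OF assms(1)] obtain k
    where k: "\<forall>M\<ge>k. \<forall>d. sublist u ((\<sigma> ^^ M) [d])" ..
  from eventually_factor[OF assms(2)] obtain l
    where l: "\<forall>M\<ge>l. \<forall>d. sublist v ((\<sigma> ^^ M) [d])" ..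
  define M where "M = max k l"
  obtain m where m: "\<And>c. length ((\<sigma> ^^ m) [c]) \<ge> N + 2 + N" using eventually_long by blast
  define c :: 'a where "c = undefined"
  define z where "z = (\<sigma> ^^ m) [c]"
  have zF: "z \<in> iterate_factors \<sigma>" unfolding z_def by (rule iterate_factorsI[of _ m _ c]) simp
  have lz: "length z \<ge> N + 2 + N" using m by (simp add: z_def)
  obtain d e z2 where z2: "drop N z = d # e # z2"
    using lz by (cases "drop N z"; cases "tl (drop N z)") (auto dest: arg_cong[of _ _ length])
  have z: "z = take N z @ [d] @ [e] @ z2" using append_take_drop_id[of N z] z2 by simp
  have lz2: "length z2 \<ge> N" using lz arg_cong[OF z2, of length] by simp
  obtain p s where ps: "(\<sigma> ^^ M) [d] = p @ u @ s" using k[rule_format, of M d] by (auto simp: M_def sublist_def)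
  obtain p' s' where ps': "(\<sigma> ^^ M) [e] = p' @ v @ s'" using l[rule_format, of M e] by (auto simp: M_def sublist_def)
  have "(\<sigma> ^^ M) z = ((\<sigma> ^^ M) (take N z) @ p) @ u @ (s @ p') @ v @ (s' @ (\<sigma> ^^ M) z2)"
  proof -
    have "(\<sigma> ^^ M) z = (\<sigma> ^^ M) (take N z @ [d] @ [e] @ z2)" by (rule arg_cong[OF z])
    also have "\<dots> = (\<sigma> ^^ M) (take N z) @ (p @ u @ s) @ (p' @ v @ s') @ (\<sigma> ^^ M) z2"
      by (simp only: pow_append ps ps')
    finally show ?thesis by simp
  qed
  moreover have "(\<sigma> ^^ M) z \<in> iterate_factors \<sigma>" by (rule pow_iterate_factors[OF zF])
  moreover have "length ((\<sigma> ^^ M) (take N z)) \<ge> N" "length ((\<sigma> ^^ M) z2) \<ge> N"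
    using nonerasing_morphism.length_le[OF nonerasing_pow, of "take N z" M]
      nonerasing_morphism.length_le[OF nonerasing_pow, of z2 M] lz lz2 by auto
  ultimately show ?thesis
    by (intro exI[of _ "(\<sigma> ^^ M) (take N z) @ p"] exI[of _ "s @ p'"] exI[of _ "s' @ (\<sigma> ^^ M) z2"]) auto
qed

text \<open>Otherwise the iterates would never grow.\<close>

lemma image_not_letter: "\<exists>c. length (\<sigma> [c]) \<noteq> 1"
proof (rule ccontr)
  assume "\<nexists>c. length (\<sigma> [c]) \<noteq> 1"
  then have \<sigma>: "length (\<sigma> [c]) = 1" for c by blast
  have "length (\<sigma> u) = length u" for u
  proof (induction u)
    case (Cons c u)
    then show ?case using \<sigma>[of c] by (subst image_Cons) simp
  qed (simp add: image_Nil)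
  then have "length ((\<sigma> ^^ n) u) = length u" for n u by (induction n) auto
  moreover obtain M where "\<And>c. length ((\<sigma> ^^ M) [c]) \<ge> 2" using eventually_long by blast
  ultimately show False by fastforce
qed

lemma iterate_factors_extend:
  assumes "u \<in> iterate_factors \<sigma>"
  shows "\<exists>x y. length x \<ge> N \<and> length y \<ge> N \<and> x @ u @ y \<in> iterate_factors \<sigma>"
proof -
  obtain x t y where "length x \<ge> N" "length y \<ge> N" "x @ u @ t @ u @ y \<in> iterate_factors \<sigma>"
    using iterate_factors_connect[OF assms assms] by blast
  then show ?thesis by (intro exI[of _ x] exI[of _ "t @ u @ y"]) auto
qed

end

subsection \<open>Periodic points and their orbit closures\<close>

lemma map_upt_of_sublist:
  assumes "sublist v (map x [0..<n])"
  shows "\<exists>i j. v = map x [i..<j]"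
proof -
  obtain p s where ps: "map x [0..<n] = p @ v @ s" using assms by (auto simp: sublist_def)
  have "length p + length v \<le> n" using arg_cong[OF ps, of length] by simp
  have "v = take (length v) (drop (length p) (map x [0..<n]))" by (simp add: ps)
  also have "\<dots> = map x (take (length v) (drop (length p) [0..<n]))"
    by (simp only: take_map drop_map)
  also have "\<dots> = map x [length p..<length p + length v]"
    using \<open>length p + length v \<le> n\<close> by (simp add: drop_upt take_upt)
  finally show ?thesis by blast
qed

lemma sublist_map_upt: "j \<le> n \<Longrightarrow> sublist (map x [i..<j]) (map x [0..<n])"
proof (cases "i \<le> j")
  case True
  assume "j \<le> n"
  with True have "[0..<n] = [0..<i] @ [i..<j] @ [j..<n]"
    by (metis append_assoc le_add_diff_inverse le_trans upt_add_eq_append zero_le)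
  then have "map x [0..<n] = map x [0..<i] @ map x [i..<j] @ map x [j..<n]"
    by (simp only: map_append)
  then show ?thesis by (simp only: sublist_appendI)
qed simp

text \<open>\<open>inf_image\<close> computes each letter from the image of a prefix that is just long enough.  Since images
  of prefixes are prefixes of each other, all longer prefixes give the same letter.\<close>

lemma fixed_point_image:
  assumes "nonerasing_morphism \<rho>" and fp: "inf_image \<rho> x = x"
  shows "\<rho> (map x [0..<n]) = map x [0..<length (\<rho> (map x [0..<n]))]"
proof (rule nth_equalityI)
  interpret nonerasing_morphism \<rho> by fact
  fix i assume i: "i < length (\<rho> (map x [0..<n]))"
  have x_i: "x i = \<rho> (map x [0..<Suc i]) ! i"
    using fun_cong[OF fp, of i] by (simp add: inf_image_def)
  have "\<rho> (map x [0..<n]) ! i = x i"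
  proof (cases "i < n")
    case True
    then have "map x [0..<n] = map x [0..<Suc i] @ map x [Suc i..<n]"
      by (metis Suc_leI le0 map_append upt_add_eq_append le_add_diff_inverse)
    then have "\<rho> (map x [0..<n]) = \<rho> (map x [0..<Suc i]) @ \<rho> (map x [Suc i..<n])"
      by (simp only: append)
    moreover have "i < length (\<rho> (map x [0..<Suc i]))"
      using length_le[of "map x [0..<Suc i]"] by simp
    ultimately show ?thesis by (simp only: x_i nth_append if_True)
  next
    case False
    then have "map x [0..<Suc i] = map x [0..<n] @ map x [n..<Suc i]"
      by (metis le0 map_append upt_add_eq_append le_add_diff_inverse not_less le_SucI)
    then have "\<rho> (map x [0..<Suc i]) = \<rho> (map x [0..<n]) @ \<rho> (map x [n..<Suc i])"
      by (simp only: append)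
    then show ?thesis using i by (simp only: x_i nth_append if_True)
  qed
  then show "\<rho> (map x [0..<n]) ! i = map x [0..<length (\<rho> (map x [0..<n]))] ! i"
    using i by simp
qed simp

lemma fixed_point_pow_image:
  assumes "nonerasing_morphism \<rho>" and fp: "inf_image \<rho> x = x"
  shows "\<exists>L. (\<rho> ^^ j) (map x [0..<n]) = map x [0..<L]"
proof (induction j)
  case 0
  show ?case by auto
next
  case (Suc j)
  then obtain L where "(\<rho> ^^ j) (map x [0..<n]) = map x [0..<L]" by blast
  then have "(\<rho> ^^ Suc j) (map x [0..<n]) = \<rho> (map x [0..<L])" by simp
  then show ?case using fixed_point_image[OF assms, of L] by metis
qed

text \<open>The cylinder of all sequences that agree with \<open>y\<close> up to \<open>N\<close> is an open neighbourhood of \<open>y\<close>.\<close>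

lemma closure_of_suffixes_agree:
  assumes "y \<in> product_topology (\<lambda>_. discrete_topology UNIV) UNIV closure_of
      range (\<lambda>n. Omega_Words_Fun.suffix n x)"
  shows "\<exists>n. \<forall>i<N. y i = x (n + i)"
proof -
  let ?T = "product_topology (\<lambda>_::nat. discrete_topology (UNIV::'a set)) UNIV"
  let ?X = "\<lambda>i. if i < N then {y i} else UNIV"
  have "finite {i. ?X i \<noteq> topspace (discrete_topology (UNIV :: 'a set))}"
    by (rule finite_subset[of _ "{..<N}"]) auto
  then have "openin ?T (PiE UNIV ?X)"
    by (intro product_topology_basis) auto
  moreover have "y \<in> PiE UNIV ?X" by (auto simp: PiE_def)
  ultimately obtain z where z: "z \<in> range (\<lambda>n. Omega_Words_Fun.suffix n x)" "z \<in> PiE UNIV ?X"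
    using assms unfolding in_closure_of by blast
  then obtain n where "z = Omega_Words_Fun.suffix n x" by blast
  moreover have "z i = y i" if "i < N" for i
    using z(2) that unfolding PiE_def Pi_def by (auto dest!: spec[of _ i])
  ultimately have "\<forall>i<N. y i = x (n + i)" by (metis suffix_nth)
  then show ?thesis by blast
qed

lemma language_eq_factors_of_periodic_point:
  fixes \<sigma> :: "'a list \<Rightarrow> 'a list"
  defines "x \<equiv> (SOME x. periodic_point \<sigma> x)"
  shows "language \<sigma> = {map x [i..<j] | i j. True}"
proof (intro equalityI subsetI)
  fix v assume "v \<in> language \<sigma>"
  then obtain y i j where v: "v = map y [i..<j]" and y: "y \<in> shift_space \<sigma>"
    by (auto simp: language_def)
  obtain n where n: "\<forall>i<j. y i = x (n + i)"
    using closure_of_suffixes_agree[of y x j] y unfolding shift_space_def x_def by blast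
  have "v = map x [n + i..<n + j]"
    unfolding v by (rule nth_equalityI) (use n in \<open>auto simp: add.assoc\<close>)
  then show "v \<in> {map x [i..<j] | i j. True}" by blast
next
  fix v assume "v \<in> {map x [i..<j] | i j. True}"
  then obtain i j where v: "v = map x [i..<j]" by blast
  have "x = Omega_Words_Fun.suffix 0 x" by simp
  then have "x \<in> range (\<lambda>n. Omega_Words_Fun.suffix n x)" by blast
  then have "x \<in> shift_space \<sigma>"
    unfolding shift_space_def x_def[symmetric]
    by (rule subsetD[OF closure_of_subset, rotated]) simp
  then show "v \<in> language \<sigma>" unfolding language_def v by blast
qed

subsection \<open>The language as a set of factors of iterates\<close>

context primitive_nonerasing
begin

text \<open>On a finite alphabet some letter \<open>c\<close> is the first letter of one of its own iterates; the
  iterates of \<open>c\<close> then extend each other and converge to a periodic point.\<close>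

lemma periodic_point_exists: "\<exists>x. periodic_point \<sigma> x"
proof -
  define f where "f c = hd (\<sigma> [c])" for c :: 'a
  have hd_pow: "hd ((\<sigma> ^^ n) [c]) = (f ^^ n) c" for n c
  proof (induction n)
    case (Suc n)
    obtain d t where dt: "(\<sigma> ^^ n) [c] = d # t"
      using nonerasing_morphism.nonempty[OF nonerasing_pow] by (meson neq_Nil_conv)
    then have "(\<sigma> ^^ Suc n) [c] = \<sigma> [d] @ \<sigma> t" by (simp add: image_Cons[of d t])
    then have "hd ((\<sigma> ^^ Suc n) [c]) = f d" by (simp add: f_def nonempty)
    then show ?case using Suc dt by simp
  qed simp
  have "\<not> inj (\<lambda>i. (f ^^ i) (undefined :: 'a))"
    using finite_imageD[of "\<lambda>i. (f ^^ i) (undefined :: 'a)" UNIV] finite_subset[OF subset_UNIV] by auto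
  then obtain i j where ij: "i < j" "(f ^^ i) (undefined :: 'a) = (f ^^ j) undefined"
    unfolding inj_def by (metis linorder_neqE_nat)
  define c where "c = (f ^^ i) (undefined :: 'a)"
  define p where "p = j - i"
  have p: "p \<ge> 1" "(f ^^ p) c = c"
  proof -
    have "(f ^^ p) c = (f ^^ (p + i)) undefined" by (simp add: c_def funpow_add)
    also have "p + i = j" using ij by (simp add: p_def)
    finally show "(f ^^ p) c = c" using ij by (simp add: c_def)
  qed (use ij in \<open>simp add: p_def\<close>)
  from eventually_long obtain l where l: "\<forall>M\<ge>l. \<forall>c. length ((\<sigma> ^^ M) [c]) \<ge> 2" ..
  \<comment> \<open>The multiple of the period \<open>p\<close> makes the image of \<open>c\<close> begin with \<open>c\<close> and have at least two
    letters, so that the iterates grow.\<close>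
  define k where "k = p * Suc l"
  have k: "k \<ge> 1" "k \<ge> l" using p(1) by (cases p; simp add: k_def)+
  define \<rho> where "\<rho> = \<sigma> ^^ k"
  interpret \<rho>: nonerasing_morphism \<rho> unfolding \<rho>_def by (rule nonerasing_pow)
  have "((f ^^ p) ^^ Suc l) c = c" by (induction l) (use p in auto)
  then have "(f ^^ k) c = c" by (simp only: k_def funpow_mult)
  then have "hd (\<rho> [c]) = c" using hd_pow[of k c] by (simp add: \<rho>_def)
  moreover have "length (\<rho> [c]) \<ge> 2" using l k by (simp add: \<rho>_def)
  ultimately obtain t where t: "\<rho> [c] = [c] @ t" "t \<noteq> []"
    by (cases "\<rho> [c]"; cases "tl (\<rho> [c])") auto
  have step: "(\<rho> ^^ Suc n) [c] = (\<rho> ^^ n) [c] @ (\<rho> ^^ n) t" for n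
    by (simp add: funpow_Suc_right t(1) nonerasing_morphism.append[OF nonerasing_morphism_funpow[OF \<rho>.nonerasing_morphism_axioms], of n "[c]" t, simplified] del: funpow.simps)
  have mono: "prefix ((\<rho> ^^ m) [c]) ((\<rho> ^^ (m + n)) [c])" for m n
  proof (induction n)
    case (Suc n)
    then show ?case using step[of "m + n"] by (auto simp: prefix_def)
  qed simp
  have len: "length ((\<rho> ^^ n) [c]) \<ge> Suc n" for n
  proof (induction n)
    case (Suc n)
    have "length ((\<rho> ^^ n) t) \<ge> 1"
      using nonerasing_morphism.length_le[OF nonerasing_morphism_funpow[OF \<rho>.nonerasing_morphism_axioms], of t n] t(2)
      by (cases t) auto
    then show ?case using Suc unfolding step by simp
  qed simp
  define x where "x i = (\<rho> ^^ i) [c] ! i" for i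
  have nth: "(\<rho> ^^ n) [c] ! i = x i" if "i < length ((\<rho> ^^ n) [c])" for n i
  proof -
    have "prefix ((\<rho> ^^ i) [c]) ((\<rho> ^^ (n + i)) [c])" "prefix ((\<rho> ^^ n) [c]) ((\<rho> ^^ (n + i)) [c])"
      using mono[of i n] mono[of n i] by (simp_all add: add.commute)
    then obtain z z' where "(\<rho> ^^ (n + i)) [c] = (\<rho> ^^ i) [c] @ z"
      and z': "(\<rho> ^^ (n + i)) [c] = (\<rho> ^^ n) [c] @ z'" by (elim prefixE)
    then have "(\<rho> ^^ (n + i)) [c] ! i = x i" using len[of i] by (simp add: nth_append x_def)
    then show ?thesis using that unfolding z' by (simp add: nth_append)
  qed
  have "inf_image \<rho> x = x"
  proof
    fix n
    have "map x [0..<Suc n] = take (Suc n) ((\<rho> ^^ n) [c])"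
      by (rule nth_equalityI) (use len[of n] nth[of _ n] in \<open>auto simp del: upt_Suc\<close>)
    then have "(\<rho> ^^ n) [c] = map x [0..<Suc n] @ drop (Suc n) ((\<rho> ^^ n) [c])"
      by (simp only: append_take_drop_id)
    then have "\<rho> ((\<rho> ^^ n) [c]) = \<rho> (map x [0..<Suc n] @ drop (Suc n) ((\<rho> ^^ n) [c]))"
      by (rule arg_cong)
    then have eq: "(\<rho> ^^ Suc n) [c] = \<rho> (map x [0..<Suc n]) @ \<rho> (drop (Suc n) ((\<rho> ^^ n) [c]))"
      by (simp only: \<rho>.append funpow.simps o_apply)
    have "n < length (\<rho> (map x [0..<Suc n]))"
      using \<rho>.length_le[of "map x [0..<Suc n]"] by simp
    then have "\<rho> (map x [0..<Suc n]) ! n = (\<rho> ^^ Suc n) [c] ! n"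
      unfolding eq by (simp only: nth_append if_True)
    also have "\<dots> = x n" using nth[of n "Suc n"] len[of "Suc n"] by simp
    finally show "inf_image \<rho> x n = x n" by (simp add: inf_image_def)
  qed
  then show ?thesis using k(1) unfolding periodic_point_def \<rho>_def by blast
qed

text \<open>Powers of \<open>\<sigma>\<close> whose exponent is a multiple of the period \<open>k\<close> map the first letter of the periodic
  point to its prefixes; any factor of the language occurs in such an iterate if the exponent is large.\<close>

theorem language_eq_iterate_factors: "language \<sigma> = iterate_factors \<sigma>"
proof -
  define x where "x = (SOME x. periodic_point \<sigma> x)"
  have "periodic_point \<sigma> x" unfolding x_def using periodic_point_exists by (rule someI_ex)
  then obtain k where k: "k \<ge> 1" and fp: "inf_image (\<sigma> ^^ k) x = x"
    unfolding periodic_point_def by blast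
  have orbit: "\<exists>L. (\<sigma> ^^ (k * j)) [x 0] = map x [0..<L]" for j
    using fixed_point_pow_image[OF nonerasing_pow fp, of j 1] by (simp add: funpow_mult)
  show ?thesis unfolding language_eq_factors_of_periodic_point x_def[symmetric]
  proof (intro equalityI subsetI)
    fix v assume "v \<in> {map x [i..<j] | i j. True}"
    then obtain i j where v: "v = map x [i..<j]" by blast
    from eventually_long obtain l where l: "\<forall>M\<ge>l. \<forall>c. length ((\<sigma> ^^ M) [c]) \<ge> j" ..
    obtain L where L: "(\<sigma> ^^ (k * l)) [x 0] = map x [0..<L]" using orbit by blast
    have "k * l \<ge> l" using k by (cases k) auto
    then have "length ((\<sigma> ^^ (k * l)) [x 0]) \<ge> j" using l by blast
    then have "j \<le> L" unfolding L by simp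
    then show "v \<in> iterate_factors \<sigma>"
      unfolding v by (intro iterate_factorsI[of _ "k * l" \<sigma> "x 0"]) (simp only: L sublist_map_upt)
  next
    fix v assume "v \<in> iterate_factors \<sigma>"
    from eventually_factor[OF this] obtain l where l: "\<forall>M\<ge>l. \<forall>d. sublist v ((\<sigma> ^^ M) [d])" ..
    obtain L where L: "(\<sigma> ^^ (k * l)) [x 0] = map x [0..<L]" using orbit by blast
    have "k * l \<ge> l" using k by (cases k) auto
    then have "sublist v (map x [0..<L])" using l unfolding L[symmetric] by blast
    then show "v \<in> {map x [i..<j] | i j. True}" using map_upt_of_sublist[of v x L] by auto
  qed
qed

end

section \<open>Episturmian morphisms\<close>

lemma psi_simps: "psi a [] = []" "psi a (b # u) = (if b = a then [a] else [a, b]) @ psi a u"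
  "psi a (u @ v) = psi a u @ psi a v"
  by (simp_all add: psi_def)

lemma psi_bar_simps: "psi_bar a [] = []"
  "psi_bar a (b # u) = (if b = a then [a] else [b, a]) @ psi_bar a u"
  "psi_bar a (u @ v) = psi_bar a u @ psi_bar a v"
  by (simp_all add: psi_bar_def)

lemma nonerasing_psi: "nonerasing_morphism (psi a)"
  by unfold_locales (simp_all add: psi_simps)

lemma nonerasing_psi_bar: "nonerasing_morphism (psi_bar a)"
  by unfold_locales (simp_all add: psi_bar_simps)

lemma nonerasing_map: "nonerasing_morphism (map \<pi>)"
  by unfold_locales simp_all

lemma nonerasing_id: "nonerasing_morphism id"
  by unfold_locales simp_all

lemma psi_conj_psi_bar: "psi a u @ [a] = [a] @ psi_bar a u"
  by (induction u) (auto simp: psi_simps psi_bar_simps)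

lemma episturmian_nonerasing: "\<sigma> \<in> episturmian \<Longrightarrow> nonerasing_morphism \<sigma>"
  by (induction rule: episturmian.induct)
    (simp_all add: nonerasing_psi nonerasing_psi_bar nonerasing_map nonerasing_id nonerasing_id[unfolded id_def]
      nonerasing_morphism_comp
      del: o_apply)

lemma standard_nonerasing: "\<sigma> \<in> standard_episturmian \<Longrightarrow> nonerasing_morphism \<sigma>"
  by (induction rule: standard_episturmian.induct)
    (simp_all add: nonerasing_psi nonerasing_map nonerasing_id nonerasing_id[unfolded id_def]
      nonerasing_morphism_comp del: o_apply)

text \<open>Only \<open>psi a\<close> needs an argument: it inserts letters in front of the letters of a word.\<close>

lemma standard_last_letter:
  "\<tau> \<in> standard_episturmian \<Longrightarrow> \<exists>\<pi>. bij \<pi> \<and> (\<forall>u. u \<noteq> [] \<longrightarrow> last (\<tau> u) = \<pi> (last u))"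
proof (induction rule: standard_episturmian.induct)
  case id
  show ?case by (intro exI[of _ id] conjI bij_id) auto
next
  case (psi a)
  have "u \<noteq> [] \<Longrightarrow> last (psi a u) = last u" for u
    by (induction u rule: rev_induct) (auto simp: psi_simps)
  then show ?case by (intro exI[of _ id] conjI bij_id) auto
next
  case (perm \<pi>)
  then show ?case by (intro exI[of _ \<pi>]) (auto simp: last_map)
next
  case (comp \<sigma> \<tau>)
  then obtain \<pi> \<pi>' where "bij \<pi>" "\<forall>u. u \<noteq> [] \<longrightarrow> last (\<sigma> u) = \<pi> (last u)"
    "bij \<pi>'" "\<forall>u. u \<noteq> [] \<longrightarrow> last (\<tau> u) = \<pi>' (last u)" by blast
  moreover have "\<tau> u \<noteq> []" if "u \<noteq> []" for u
    using nonerasing_morphism.eq_Nil_iff[OF standard_nonerasing[OF comp.hyps(2)]] that by blast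
  ultimately show ?case by (intro exI[of _ "\<pi> \<circ> \<pi>'"] conjI bij_comp) auto
qed

subsection \<open>Conjugates and the conjugacy index\<close>

lemma conjugate_by_words:
  assumes "nonerasing_morphism \<sigma>" "nonerasing_morphism \<rho>" "conjugate_by \<sigma> w \<rho>"
  shows "\<sigma> u @ w = w @ \<rho> u"
proof (induction u)
  case Nil
  then show ?case using assms(1,2) by (simp add: nonerasing_morphism.image_Nil)
next
  case (Cons c u)
  have "\<sigma> (c # u) @ w = \<sigma> [c] @ \<sigma> u @ w"
    by (subst nonerasing_morphism.image_Cons[OF assms(1)]) simp
  also have "\<dots> = (\<sigma> [c] @ w) @ \<rho> u" by (simp add: Cons)
  also have "\<dots> = w @ \<rho> [c] @ \<rho> u" using assms(3) by (simp add: conjugate_by_def)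
  also have "\<rho> [c] @ \<rho> u = \<rho> (c # u)" using nonerasing_morphism.image_Cons[OF assms(2)] by metis
  finally show ?case .
qed

lemma conjugate_by_comp:
  assumes "nonerasing_morphism \<sigma>" "nonerasing_morphism \<rho>"
    and "conjugate_by \<sigma> w \<rho>" "conjugate_by \<sigma>' w' \<rho>'"
  shows "conjugate_by (\<sigma> \<circ> \<sigma>') (w @ \<rho> w') (\<rho> \<circ> \<rho>')"
  unfolding conjugate_by_def
proof
  fix a
  have \<sigma>: "\<sigma> u @ w = w @ \<rho> u" for u by (rule conjugate_by_words[OF assms(1,2,3)])
  have "(\<sigma> \<circ> \<sigma>') [a] @ w @ \<rho> w' = \<sigma> (\<sigma>' [a]) @ \<sigma> w' @ w" by (simp add: \<sigma>)
  also have "\<dots> = \<sigma> (\<sigma>' [a] @ w') @ w" by (simp add: nonerasing_morphism.append[OF assms(1)])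
  also have "\<dots> = w @ \<rho> (w' @ \<rho>' [a])" using assms(4) by (simp add: conjugate_by_def \<sigma>)
  finally show "(\<sigma> \<circ> \<sigma>') [a] @ w @ \<rho> w' = (w @ \<rho> w') @ (\<rho> \<circ> \<rho>') [a]"
    by (simp add: nonerasing_morphism.append[OF assms(2)])
qed

text \<open>The word \<open>w\<close> moves \<open>\<sigma>\<close> to its standard conjugate and \<open>q\<close> moves it to the other end of its
  conjugacy class.  The length of \<open>w @ q\<close> is what is needed later, but the length of
  \<open>\<sigma> (w' @ q')\<close>, which enters for a composition, depends on how often each letter occurs in
  \<open>w' @ q'\<close>.  Counting the letters one by one makes the induction over the composition work.\<close>

lemma episturmian_conjugates:
  fixes \<sigma> :: "'a::finite list \<Rightarrow> 'a list"
  assumes "\<sigma> \<in> episturmian"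
  shows "\<exists>w q \<tau> \<theta>. \<tau> \<in> standard_episturmian \<and> nonerasing_morphism \<theta> \<and>
    conjugate_by \<tau> w \<sigma> \<and> conjugate_by \<sigma> q \<theta> \<and>
    (\<forall>c. (\<Sum>x\<in>UNIV. count_list (\<sigma> [x]) c) = (CARD('a) - 1) * count_list (w @ q) c + 1)"
  using assms
proof (induction rule: episturmian.induct)
  case id
  have "count_list [x] c = (if x = c then 1 else 0)" for x c :: 'a by simp
  then show ?case
    by (intro exI[of _ "[]"] exI[of _ id])
      (simp add: nonerasing_id[unfolded id_def] standard_episturmian.id[unfolded id_def] conjugate_by_def)
next
  case (psi a)
  have "(\<Sum>x\<in>UNIV. count_list (psi a [x]) c) = (CARD('a) - 1) * count_list [a] c + 1" for c
  proof -
    have "count_list (psi a [x]) c = (if a = c then 1 else if x = c then 1 else 0)" for x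
      by (auto simp: psi_simps)
    moreover have "CARD('a) - 1 + 1 = CARD('a)" using zero_less_card_finite by simp
    ultimately show ?thesis by (cases "a = c") simp_all
  qed
  then show ?case
    by (intro exI[of _ "[]"] exI[of _ "[a]"] exI[of _ "psi a"] exI[of _ "psi_bar a"])
      (simp add: nonerasing_psi_bar standard_episturmian.psi conjugate_by_def psi_conj_psi_bar[simplified])
next
  case (psi_bar a)
  have "(\<Sum>x\<in>UNIV. count_list (psi_bar a [x]) c) = (CARD('a) - 1) * count_list [a] c + 1" for c
  proof -
    have "count_list (psi_bar a [x]) c = (if a = c then 1 else if x = c then 1 else 0)" for x
      by (auto simp: psi_bar_simps)
    moreover have "CARD('a) - 1 + 1 = CARD('a)" using zero_less_card_finite by simp
    ultimately show ?thesis by (cases "a = c") simp_all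
  qed
  then show ?case
    by (intro exI[of _ "[a]"] exI[of _ "[]"] exI[of _ "psi a"] exI[of _ "psi_bar a"])
      (simp add: nonerasing_psi_bar standard_episturmian.psi conjugate_by_def psi_conj_psi_bar[simplified])
next
  case (perm \<pi>)
  have "count_list (map \<pi> [x]) c = (if x = inv \<pi> c then 1 else 0)" for x c
    using perm by (auto simp: bij_inv_eq_iff)
  then show ?case using perm
    by (intro exI[of _ "[]"] exI[of _ "map \<pi>"])
      (simp add: nonerasing_map standard_episturmian.perm conjugate_by_def)
next
  case (comp \<sigma> \<sigma>')
  obtain w q \<tau> \<theta> where 1: "\<tau> \<in> standard_episturmian" "nonerasing_morphism \<theta>"
    "conjugate_by \<tau> w \<sigma>" "conjugate_by \<sigma> q \<theta>"
    and count: "\<And>c. (\<Sum>x\<in>UNIV. count_list (\<sigma> [x]) c) = (CARD('a) - 1) * count_list (w @ q) c + 1"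
    using comp.IH(1) by blast
  obtain w' q' \<tau>' \<theta>' where 2: "\<tau>' \<in> standard_episturmian" "nonerasing_morphism \<theta>'"
    "conjugate_by \<tau>' w' \<sigma>'" "conjugate_by \<sigma>' q' \<theta>'"
    and count': "\<And>c. (\<Sum>x\<in>UNIV. count_list (\<sigma>' [x]) c) = (CARD('a) - 1) * count_list (w' @ q') c + 1"
    using comp.IH(2) by blast
  interpret \<sigma>: nonerasing_morphism \<sigma> by (rule episturmian_nonerasing[OF comp.hyps(1)])
  have "conjugate_by (\<sigma> \<circ> \<sigma>') (\<sigma> q' @ q) (\<theta> \<circ> \<theta>')"
  proof -
    have "\<sigma> q' @ q = q @ \<theta> q'" by (rule conjugate_by_words[OF \<sigma>.nonerasing_morphism_axioms 1(2,4)])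
    then show ?thesis using conjugate_by_comp[OF \<sigma>.nonerasing_morphism_axioms 1(2,4) 2(4)] by simp
  qed
  moreover have "conjugate_by (\<tau> \<circ> \<tau>') (w @ \<sigma> w') (\<sigma> \<circ> \<sigma>')"
    by (rule conjugate_by_comp[OF standard_nonerasing[OF 1(1)] \<sigma>.nonerasing_morphism_axioms 1(3) 2(3)])
  moreover have "(\<Sum>x\<in>UNIV. count_list ((\<sigma> \<circ> \<sigma>') [x]) d)
      = (CARD('a) - 1) * count_list ((w @ \<sigma> w') @ (\<sigma> q' @ q)) d + 1" for d
  proof -
    note count_\<sigma> = count_list_image[OF \<sigma>.nonerasing_morphism_axioms, of _ d]
    have "(\<Sum>x\<in>UNIV. count_list ((\<sigma> \<circ> \<sigma>') [x]) d)
        = (\<Sum>x\<in>UNIV. \<Sum>c\<in>UNIV. count_list (\<sigma>' [x]) c * count_list (\<sigma> [c]) d)"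
      by (simp only: o_apply count_\<sigma>[of "\<sigma>' [x]" for x])
    also have "\<dots> = (\<Sum>c\<in>UNIV. (\<Sum>x\<in>UNIV. count_list (\<sigma>' [x]) c) * count_list (\<sigma> [c]) d)"
      by (subst sum.swap) (simp add: sum_distrib_right)
    also have "\<dots> = (\<Sum>c\<in>UNIV. (CARD('a) - 1) * (count_list (w' @ q') c * count_list (\<sigma> [c]) d)
        + count_list (\<sigma> [c]) d)"
      unfolding count' by (rule sum.cong) (simp_all add: algebra_simps)
    also have "\<dots> = (CARD('a) - 1) * count_list (\<sigma> (w' @ q')) d + (\<Sum>c\<in>UNIV. count_list (\<sigma> [c]) d)"
      by (simp only: sum.distrib count_\<sigma>[of "w' @ q'"] sum_distrib_left)
    also have "\<dots> = (CARD('a) - 1) * count_list (\<sigma> (w' @ q')) d + ((CARD('a) - 1) * count_list (w @ q) d + 1)"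
      by (simp only: count)
    finally show ?thesis by (simp add: \<sigma>.append distrib_left add_ac del: One_nat_def)
  qed
  moreover have "\<tau> \<circ> \<tau>' \<in> standard_episturmian" using 1 2 by (rule_tac standard_episturmian.comp)
  moreover have "nonerasing_morphism (\<theta> \<circ> \<theta>')" using 1 2 by (rule_tac nonerasing_morphism_comp)
  ultimately show ?case by blast
qed

lemma total_length_conjugates:
  fixes \<sigma> :: "'a::finite list \<Rightarrow> 'a list"
  assumes "\<forall>c. (\<Sum>x\<in>UNIV. count_list (\<sigma> [x]) c) = (CARD('a) - 1) * count_list p c + 1"
  shows "total_length \<sigma> = (CARD('a) - 1) * length p + CARD('a)"
proof -
  have len: "length u = (\<Sum>c\<in>UNIV. count_list u c)" for u :: "'a list"
    by (rule sum_count_set[symmetric]) auto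
  have "total_length \<sigma> = (\<Sum>x\<in>UNIV. \<Sum>c\<in>UNIV. count_list (\<sigma> [x]) c)"
    by (simp only: total_length_def len)
  also have "\<dots> = (\<Sum>c\<in>UNIV. (CARD('a) - 1) * count_list p c + 1)"
    by (subst sum.swap) (simp only: assms)
  also have "\<dots> = (CARD('a) - 1) * length p + CARD('a)"
    by (simp only: sum.distrib sum_distrib_left[symmetric] len[symmetric]) simp
  finally show ?thesis .
qed

lemma longer_suffix:
  assumes "x @ w = y @ v" "length v \<le> length w"
  shows "\<exists>z. w = z @ v"
proof -
  from assms(1) consider z where "w = z @ v" | z where "v = z @ w"
    by (auto simp: append_eq_append_conv2)
  then show ?thesis using assms(2) by cases auto
qed

lemma longer_prefix:
  assumes "v @ x = w @ y" "length w \<le> length v"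
  shows "\<exists>z. v = w @ z"
proof -
  from assms(1) consider z where "v = w @ z" | z where "w = v @ z"
    by (auto simp: append_eq_append_conv2)
  then show ?thesis using assms(2) by cases auto
qed

text \<open>Two standard conjugates of \<open>\<sigma>\<close> would be conjugate to each other by a word whose last letter is
  the last letter of the image of every letter, but the images of the letters under a standard
  morphism end with different letters.\<close>

lemma ind_eq_length:
  fixes \<sigma> :: "'a::finite list \<Rightarrow> 'a list"
  assumes card: "CARD('a) \<ge> 2" and \<sigma>: "nonerasing_morphism \<sigma>"
    and \<tau>: "\<tau> \<in> standard_episturmian" and conj: "conjugate_by \<tau> w \<sigma>"
  shows "ind \<sigma> = length w"
proof -
  have le: "w' = w" if asm: "\<tau> \<in> standard_episturmian" "conjugate_by \<tau> w \<sigma>"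
    "\<tau>' \<in> standard_episturmian" "conjugate_by \<tau>' w' \<sigma>" "length w \<le> length w'" for \<tau> \<tau>' w w'
  proof -
    note conj_w = conjugate_by_words[OF standard_nonerasing[OF asm(1)] \<sigma> asm(2)]
    note conj_w' = conjugate_by_words[OF standard_nonerasing[OF asm(3)] \<sigma> asm(4)]
    \<comment> \<open>A word long enough that its image has both \<open>w\<close> and \<open>w'\<close> as suffixes.\<close>
    define u where "u = replicate (length w') (undefined :: 'a)"
    have len: "length w' \<le> length (\<sigma> u)"
      using nonerasing_morphism.length_le[OF \<sigma>, of u] by (simp add: u_def)
    obtain z z' where "\<sigma> u = z @ w" "\<sigma> u = z' @ w'"
      using longer_suffix[OF conj_w[of u, symmetric]] longer_suffix[OF conj_w'[of u, symmetric]]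
        len \<open>length w \<le> length w'\<close> by auto
    then have zz: "z @ w = z' @ w'" by simp
    with \<open>length w \<le> length w'\<close> obtain t where t: "w' = t @ w"
      by (auto simp: append_eq_append_conv2)
    \<comment> \<open>\<open>t\<close> conjugates \<open>\<tau>'\<close> to \<open>\<tau>\<close>.\<close>
    have "t = []"
    proof (rule ccontr)
      assume "t \<noteq> []"
      obtain \<pi> where \<pi>: "bij \<pi>" "\<And>u. u \<noteq> [] \<Longrightarrow> last (\<tau> u) = \<pi> (last u)"
        using standard_last_letter[OF asm(1)] by blast
      have "\<pi> x = last t" for x
      proof -
        have "\<tau>' [x] @ t @ w = t @ w @ \<sigma> [x]" using conj_w'[of "[x]"] by (simp add: t)
        also have "\<dots> = t @ \<tau> [x] @ w" using conj_w[of "[x]"] by simp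
        finally have "\<tau>' [x] @ t = t @ \<tau> [x]" by simp
        then have "last (\<tau>' [x] @ t) = last (t @ \<tau> [x])" by simp
        moreover have "\<tau> [x] \<noteq> []"
          by (rule nonerasing_morphism.nonempty[OF standard_nonerasing[OF asm(1)]])
        ultimately show ?thesis using \<open>t \<noteq> []\<close> \<pi>(2)[of "[x]"] by simp
      qed
      then have "(UNIV :: 'a set) = {undefined}"
        using \<pi>(1) by (metis (full_types) UNIV_eq_I bij_pointE insertI1 singletonI)
      then have "CARD('a) = card {undefined :: 'a}" by (rule arg_cong)
      then show False using card by simp
    qed
    then show ?thesis using t by simp
  qed
  have "(THE w. \<exists>\<tau>\<in>standard_episturmian. conjugate_by \<tau> w \<sigma>) = w"
  proof (rule the_equality)
    show "\<exists>\<tau>\<in>standard_episturmian. conjugate_by \<tau> w \<sigma>" using \<tau> conj by blast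
  next
    fix w' assume "\<exists>\<tau>\<in>standard_episturmian. conjugate_by \<tau> w' \<sigma>"
    then obtain \<tau>' where "\<tau>' \<in> standard_episturmian" "conjugate_by \<tau>' w' \<sigma>" by blast
    then show "w' = w" using le[OF \<tau> conj, of \<tau>' w'] le[of \<tau>' w' \<tau> w] \<tau> conj
      by (metis nat_le_linear)
  qed
  then show ?thesis by (simp add: ind_def)
qed

text \<open>The words \<open>\<tau> [c]\<close> have different last letters, so an image can be decoded from its end.\<close>

lemma standard_inj:
  assumes "\<tau> \<in> standard_episturmian"
  shows "inj \<tau>"
proof (rule injI)
  interpret nonerasing_morphism \<tau> by (rule standard_nonerasing[OF assms])
  obtain \<pi> where \<pi>: "bij \<pi>" "\<And>u. u \<noteq> [] \<Longrightarrow> last (\<tau> u) = \<pi> (last u)"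
    using standard_last_letter[OF assms] by blast
  fix u v show "\<tau> u = \<tau> v \<Longrightarrow> u = v"
  proof (induction u arbitrary: v rule: rev_induct)
    case Nil
    then show ?case using eq_Nil_iff image_Nil by metis
  next
    case (snoc x u)
    then have "v \<noteq> []" using eq_Nil_iff by (metis snoc_eq_iff_butlast)
    then obtain v' y where v: "v = v' @ [y]" by (metis append_butlast_last_id)
    then have "x = y" using snoc.prems \<pi>(2)[of "u @ [x]"] \<pi>(2)[of v] bij_is_inj[OF \<pi>(1)]
      by (simp add: inj_eq)
    then show ?case using snoc by (simp add: v append)
  qed
qed

lemma conjugate_inj:
  assumes "\<tau> \<in> standard_episturmian" "nonerasing_morphism \<sigma>" "conjugate_by \<tau> w \<sigma>"
  shows "inj \<sigma>"
proof (rule injI)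
  note conj = conjugate_by_words[OF standard_nonerasing[OF assms(1)] assms(2,3)]
  fix u v assume "\<sigma> u = \<sigma> v"
  then have "\<tau> u @ w = \<tau> v @ w" by (simp add: conj)
  then show "u = v" using standard_inj[OF assms(1)] by (simp add: inj_eq)
qed

subsection \<open>The minimal letter\<close>

text \<open>Permuting the letters first does not change the shape of the images, and any further morphism
  preserves strict inclusion of multisets of letters; so only the innermost generator that is not a
  permutation matters.\<close>

lemma episturmian_minimal_image:
  assumes "\<sigma> \<in> episturmian"
  shows "(\<exists>\<pi>. bij \<pi> \<and> \<sigma> = map \<pi>) \<or> (\<exists>a. \<forall>b. b \<noteq> a \<longrightarrow> mset (\<sigma> [a]) \<subset># mset (\<sigma> [b]))"
  using assms
proof (induction rule: episturmian.induct)
  case id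
  show ?case by (intro disjI1 exI[of _ id] conjI bij_id) auto
next
  case (psi a)
  show ?case by (intro disjI2 exI[of _ a]) (auto simp: psi_simps subset_mset.less_le)
next
  case (psi_bar a)
  show ?case by (intro disjI2 exI[of _ a]) (auto simp: psi_bar_simps subset_mset.less_le)
next
  case (perm \<pi>)
  then show ?case by blast
next
  case (comp \<sigma> \<sigma>')
  interpret nonerasing_morphism \<sigma> by (rule episturmian_nonerasing[OF comp.hyps(1)])
  have mset_image: "mset (\<sigma> u) = \<Sum>\<^sub># (image_mset (\<lambda>c. mset (\<sigma> [c])) (mset u))" for u
  proof (induction u)
    case Nil
    then show ?case by (simp add: image_Nil)
  next
    case (Cons c u)
    then show ?case by (subst image_Cons) simp
  qed
  have mono: "mset (\<sigma> u) \<subset># mset (\<sigma> v)" if "mset u \<subset># mset v" for u v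
  proof -
    obtain M where M: "mset v = mset u + M" "M \<noteq> {#}"
      using \<open>mset u \<subset># mset v\<close> by (metis subset_mset.less_le subset_mset.le_iff_add add.right_neutral)
    then obtain c N where "M = add_mset c N" by (meson multi_nonempty_split)
    then have "mset (\<sigma> v) = mset (\<sigma> u) + mset (\<sigma> [c]) + \<Sum>\<^sub># (image_mset (\<lambda>c. mset (\<sigma> [c])) N)"
      by (simp add: mset_image[of u] mset_image[of v] M(1) add.assoc)
    then show ?thesis using nonempty[of c] by (simp add: subset_mset.less_le add.assoc)
  qed
  consider (perm) \<pi> where "bij \<pi>" "\<sigma>' = map \<pi>" | (min) a where "\<forall>b. b \<noteq> a \<longrightarrow> mset (\<sigma>' [a]) \<subset># mset (\<sigma>' [b])"
    using comp.IH(2) by blast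
  then show ?case
  proof cases
    case perm
    consider \<pi>' where "bij \<pi>'" "\<sigma> = map \<pi>'" | a where "\<forall>b. b \<noteq> a \<longrightarrow> mset (\<sigma> [a]) \<subset># mset (\<sigma> [b])"
      using comp.IH(1) by blast
    then show ?thesis
    proof cases
      case 1
      then show ?thesis using perm by (intro disjI1 exI[of _ "\<pi>' \<circ> \<pi>"] conjI bij_comp) auto
    next
      case 2
      have "\<pi> (inv \<pi> a) = a" using perm(1) by (simp add: bij_is_surj surj_f_inv_f)
      moreover have "\<pi> b \<noteq> a" if "b \<noteq> inv \<pi> a" for b
        using perm(1) that by (metis bij_inv_eq_iff)
      ultimately show ?thesis using 2 perm(2) by (intro disjI2 exI[of _ "inv \<pi> a"]) simp
    qed
  next
    case min
    then show ?thesis using mono by (intro disjI2 exI[of _ a]) simp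
  qed
qed

lemma minimal_letter_exists:
  fixes \<sigma> :: "'a::finite list \<Rightarrow> 'a list"
  assumes "\<sigma> \<in> episturmian" "primitive_morphism \<sigma>" "CARD('a) \<ge> 2"
  shows "\<exists>a. minimal_letter \<sigma> a"
proof -
  interpret primitive_nonerasing \<sigma>
    using episturmian_nonerasing[OF assms(1)] assms(2,3)
    by (simp add: primitive_nonerasing_def primitive_nonerasing_axioms_def)
  have "\<sigma> \<noteq> map \<pi>" for \<pi> using image_not_letter by auto
  then obtain a where "\<forall>b. b \<noteq> a \<longrightarrow> mset (\<sigma> [a]) \<subset># mset (\<sigma> [b])"
    using episturmian_minimal_image[OF assms(1)] by blast
  then have "\<forall>b. b \<noteq> a \<longrightarrow> length (\<sigma> [a]) < length (\<sigma> [b])"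
    using mset_subset_size by fastforce
  then show ?thesis by (auto simp: minimal_letter_def)
qed

section \<open>Special factors\<close>

text \<open>In a product of generators, permutations can be pushed to the right past elementary morphisms.\<close>

lemma episturmian_first_factor:
  assumes "\<sigma> \<in> episturmian"
  shows "(\<exists>\<pi>. bij \<pi> \<and> \<sigma> = map \<pi>) \<or>
    (\<exists>a \<mu> \<sigma>'. \<mu> \<in> {psi a, psi_bar a} \<and> \<sigma>' \<in> episturmian \<and> \<sigma> = \<mu> \<circ> \<sigma>')"
  using assms
proof (induction rule: episturmian.induct)
  case id
  show ?case by (intro disjI1 exI[of _ id] conjI bij_id) auto
next
  case (psi a)
  show ?case
    by (intro disjI2 exI[of _ a] exI[of _ "psi a"] exI[of _ id] conjI episturmian.id) simp_all
next
  case (psi_bar a)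
  show ?case
    by (intro disjI2 exI[of _ a] exI[of _ "psi_bar a"] exI[of _ id] conjI episturmian.id) simp_all
next
  case (perm \<pi>)
  then show ?case by blast
next
  case (comp \<sigma> \<tau>)
  consider (perm) \<pi> where "bij \<pi>" "\<sigma> = map \<pi>"
    | (elem) a \<mu> \<sigma>' where "\<mu> \<in> {psi a, psi_bar a}" "\<sigma>' \<in> episturmian" "\<sigma> = \<mu> \<circ> \<sigma>'"
    using comp.IH(1) by blast
  then show ?case
  proof cases
    case perm
    consider (perm') \<pi>' where "bij \<pi>'" "\<tau> = map \<pi>'"
      | (elem') a \<mu> \<sigma>' where "\<mu> \<in> {psi a, psi_bar a}" "\<sigma>' \<in> episturmian" "\<tau> = \<mu> \<circ> \<sigma>'"
      using comp.IH(2) by blast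
    then show ?thesis
    proof cases
      case perm'
      then show ?thesis using perm by (intro disjI1 exI[of _ "\<pi> \<circ> \<pi>'"] conjI bij_comp) auto
    next
      case elem'
      \<comment> \<open>A permutation moves past an elementary morphism by renaming its letter.\<close>
      have inj: "\<pi> x = \<pi> y \<longleftrightarrow> x = y" for x y using perm(1) by (simp add: bij_is_inj inj_eq)
      have "map \<pi> (psi a u) = psi (\<pi> a) (map \<pi> u)" "map \<pi> (psi_bar a u) = psi_bar (\<pi> a) (map \<pi> u)" for u
        by (induction u) (simp_all add: psi_simps psi_bar_simps inj)
      then obtain \<mu>' where "\<mu>' \<in> {psi (\<pi> a), psi_bar (\<pi> a)}" "\<And>u. map \<pi> (\<mu> u) = \<mu>' (map \<pi> u)"
        using elem'(1) by blast
      then show ?thesis using perm elem'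
        by (intro disjI2 exI[of _ "\<pi> a"] exI[of _ \<mu>'] exI[of _ "map \<pi> \<circ> \<sigma>'"] conjI
            episturmian.comp episturmian.perm) auto
    qed
  next
    case elem
    then show ?thesis using comp.hyps(2)
      by (intro disjI2 exI[of _ a] exI[of _ \<mu>] exI[of _ "\<sigma>' \<circ> \<tau>"] conjI episturmian.comp) auto
  qed
qed

subsection \<open>Desubstitution\<close>

lemma psi_hd: "u \<noteq> [] \<Longrightarrow> \<exists>t. psi a u = a # t"
  by (cases u) (auto simp: psi_simps)

lemma psi_append_hd: "\<exists>t'. psi a u @ a # t = a # t'"
  by (cases u) (auto simp: psi_simps)

lemma psi_last: "u \<noteq> [] \<Longrightarrow> last (psi a u) = last u"
  by (induction u rule: rev_induct) (auto simp: psi_simps)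

lemma psi_eq_iff: "psi a u = psi a v \<longleftrightarrow> u = v"
  by (rule inj_eq[OF standard_inj[OF standard_episturmian.psi]])

text \<open>Each block of \<open>psi a\<close> contains \<open>a\<close> only at its beginning, so one can cut before any \<open>a\<close>.\<close>

lemma psi_cut:
  "psi a z = s @ a # t \<Longrightarrow> \<exists>z1 z2. z = z1 @ z2 \<and> psi a z1 = s \<and> psi a z2 = a # t"
proof (induction z arbitrary: s)
  case (Cons c z)
  show ?case
  proof (cases "s = []")
    case True
    then show ?thesis using Cons.prems by (intro exI[of _ "[]"] exI[of _ "c # z"]) (simp add: psi_simps)
  next
    case False
    let ?b = "if c = a then [a] else [a, c]"
    obtain s' where s': "s = ?b @ s'"
      using Cons.prems False by (cases s; cases "tl s") (auto simp: psi_simps split: if_splits)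
    then have "psi a z = s' @ a # t" using Cons.prems by (simp add: psi_simps split: if_splits)
    then obtain z1 z2 where "z = z1 @ z2" "psi a z1 = s'" "psi a z2 = a # t" using Cons.IH by blast
    then show ?thesis using s' by (intro exI[of _ "c # z1"] exI[of _ z2]) (simp add: psi_simps)
  qed
qed (simp add: psi_simps)

lemma psi_before_other:
  "sublist [x, b] (psi a z) \<Longrightarrow> b \<noteq> a \<Longrightarrow> x = a"
proof (induction z)
  case (Cons c z)
  have "prefix [b] (psi a z) \<Longrightarrow> b = a" using psi_hd[of z a] by (cases "z = []") (auto simp: psi_simps)
  then show ?case using Cons by (auto simp: psi_simps sublist_Cons_right split: if_splits)
qed (simp add: psi_simps)

text \<open>One can cut before both occurrences of \<open>a\<close> that delimit \<open>psi a u\<close>; the block that ends just before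
  \<open>psi a u\<close> ends with \<open>c\<close> and hence is the block of \<open>c\<close>.\<close>

lemma psi_desubstitute:
  assumes "sublist (c # psi a u @ [a]) (psi a z)"
  shows "sublist (c # u) z"
proof -
  obtain s t where st: "psi a z = (s @ [c]) @ psi a u @ a # t" using assms by (auto simp: sublist_def)
  obtain t' where t': "psi a u @ a # t = a # t'" using psi_append_hd by metis
  obtain z1 z2 where z: "z = z1 @ z2" "psi a z1 = s @ [c]" "psi a z2 = psi a u @ a # t"
    using psi_cut[of a z "s @ [c]" t'] st t' by auto
  obtain z3 z4 where z3: "z2 = z3 @ z4" "psi a z3 = psi a u" using psi_cut[OF z(3)] by blast
  have "z1 \<noteq> []" using z(2) by (auto simp: psi_simps)
  then have "last z1 = c" using psi_last[of z1 a] z(2) by simp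
  then have "z1 = butlast z1 @ [c]" using \<open>z1 \<noteq> []\<close> append_butlast_last_id by metis
  then have "z = butlast z1 @ (c # u) @ z4" using z(1) z3 by (simp add: psi_eq_iff)
  then show ?thesis by (metis sublist_appendI)
qed

text \<open>A last letter other than \<open>a\<close> has a block of two letters.\<close>

lemma psi_length_less: "u \<noteq> [] \<Longrightarrow> last u \<noteq> a \<Longrightarrow> length u < length (psi a u)"
proof (induction u rule: rev_induct)
  case (snoc x u)
  then show ?case using nonerasing_morphism.length_le[OF nonerasing_psi, of u a] by (simp add: psi_simps)
qed simp

lemma psi_prefix_mono:
  assumes "prefix u v" shows "prefix (psi a u @ [a]) (psi a v @ [a])"
proof -
  obtain t where t: "v = u @ t" using assms by (auto simp: prefix_def)
  obtain t' where "psi a t @ [a] = a # t'" using psi_append_hd[of a t "[]"] by auto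
  then show ?thesis by (simp add: t psi_simps)
qed

text \<open>In a word \<open>psi a z\<close> a letter other than \<open>a\<close> is preceded and followed by \<open>a\<close> only.  Hence a
  left special word that is not empty begins with \<open>a\<close> and has, possibly after the forced extension by \<open>a\<close>, the form \<open>psi a u' @ [a]\<close>.\<close>

lemma left_special_desubstitute:
  assumes "c \<noteq> d" "u \<noteq> []"
    and c: "c # u @ [e] \<in> F" and d: "d # u @ [e'] \<in> F"
    and F: "\<And>v. v \<in> F \<Longrightarrow> \<exists>z\<in>G. sublist v (psi a z)"
    and G: "\<And>z v. z \<in> G \<Longrightarrow> sublist v z \<Longrightarrow> v \<in> G"
  shows "\<exists>u'. length u' < length u \<and> prefix u (psi a u' @ [a]) \<and> c # u' \<in> G \<and> d # u' \<in> G"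
proof -
  obtain z where z: "z \<in> G" "sublist (c # u @ [e]) (psi a z)" using F[OF c] by blast
  obtain y where y: "y \<in> G" "sublist (d # u @ [e']) (psi a y)" using F[OF d] by blast
  have two: "x = a \<or> x' = a"
    if "sublist (p @ [x, x'] @ s) (psi a z) \<or> sublist (p @ [x, x'] @ s) (psi a y)" for p x x' s
  proof -
    have "sublist [x, x'] (p @ [x, x'] @ s)" by (rule sublist_appendI)
    then show ?thesis using that psi_before_other by (meson sublist_order.order.trans)
  qed
  have "hd u = a"
  proof (rule ccontr)
    assume hd: "hd u \<noteq> a"
    have "u = hd u # tl u" using \<open>u \<noteq> []\<close> by simp
    then have "c # u @ [e] = [] @ [c, hd u] @ (tl u @ [e])" "d # u @ [e'] = [] @ [d, hd u] @ (tl u @ [e'])"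
      by (metis append_Cons append_Nil)+
    then have "c = a" "d = a" using two hd z(2) y(2) by metis+
    then show False using \<open>c \<noteq> d\<close> by simp
  qed
  have u_last: "u = butlast u @ [last u]" using \<open>u \<noteq> []\<close> by simp
  \<comment> \<open>\<open>V @ [a]\<close> is \<open>u\<close> itself, or \<open>u\<close> with its forced right extension.\<close>
  define V where "V = (if last u = a then butlast u else u)"
  have after: "e = a" "e' = a" if "last u \<noteq> a"
  proof -
    have "c # u @ [e] = (c # butlast u) @ [last u, e] @ []" "d # u @ [e'] = (d # butlast u) @ [last u, e'] @ []"
      by (subst u_last; simp)+
    then show "e = a" "e' = a" using two that z(2) y(2) by metis+
  qed
  have pre: "prefix u (V @ [a])" using u_last by (auto simp: V_def)
  have pc: "prefix (c # V @ [a]) (c # u @ [e])" and pd: "prefix (d # V @ [a]) (d # u @ [e'])"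
    using after u_last by (auto simp: V_def)
  have Vz: "sublist (c # V @ [a]) (psi a z)" using pc z(2) by (meson prefix_imp_sublist sublist_order.order.trans)
  have Vy: "sublist (d # V @ [a]) (psi a y)" using pd y(2) by (meson prefix_imp_sublist sublist_order.order.trans)
  obtain t where t: "V @ [a] = a # t"
    using pre \<open>hd u = a\<close> \<open>u \<noteq> []\<close> by (cases u; cases V) auto
  obtain p s where "psi a z = p @ (c # V @ [a]) @ s" using Vz by (auto simp: sublist_def)
  then have ps: "psi a z = (p @ [c]) @ (V @ [a]) @ s" by simp
  then have "psi a z = (p @ [c]) @ a # (t @ s)" by (simp only: t append_Cons)
  from psi_cut[OF this] obtain z2 where "psi a z2 = a # (t @ s)" by blast
  then have "psi a z2 = V @ a # s" using arg_cong[OF t, of "\<lambda>w. w @ s"] by simp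
  from psi_cut[OF this] obtain u' where u': "psi a u' = V" by blast
  have "length u' < length u"
  proof (cases "last u = a")
    case True
    have "length u' \<le> length V"
      using nonerasing_morphism.length_le[OF nonerasing_psi, of u' a] by (simp add: u')
    moreover have "length V < length u" using True \<open>u \<noteq> []\<close> by (simp add: V_def)
    ultimately show ?thesis by simp
  next
    case False
    then have V: "V = u" by (simp add: V_def)
    have "u' \<noteq> []" using u' \<open>u \<noteq> []\<close> V by (auto simp: psi_simps)
    then show ?thesis using psi_length_less[of u' a] psi_last[of u' a] u' V False by simp
  qed
  moreover have "c # u' \<in> G" using psi_desubstitute[of c a u' z] Vz G[OF z(1)] by (simp add: u')
  moreover have "d # u' \<in> G" using psi_desubstitute[of d a u' y] Vy G[OF y(1)] by (simp add: u')
  ultimately show ?thesis using pre u' by blast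
qed

lemma episturmian_letter_occurs:
  fixes \<sigma> :: "'a::finite list \<Rightarrow> 'a list"
  assumes "\<sigma> \<in> episturmian" shows "\<exists>x. c \<in> set (\<sigma> [x])"
proof (rule ccontr)
  assume "\<nexists>x. c \<in> set (\<sigma> [x])"
  then have "(\<Sum>x\<in>UNIV. count_list (\<sigma> [x]) c) = 0" by (simp add: count_list_0_iff)
  moreover have "(\<Sum>x\<in>UNIV. count_list (\<sigma> [x]) c) \<ge> 1"
    using episturmian_conjugates[OF assms] by (metis le_add2)
  ultimately show False by simp
qed

locale primitive_episturmian = primitive_nonerasing +
  assumes episturmian: "\<sigma> \<in> episturmian"

lemma primitive_episturmianI:
  fixes \<sigma> :: "'a::finite list \<Rightarrow> 'a list"
  assumes "\<sigma> \<in> episturmian" "primitive_morphism \<sigma>" "CARD('a) \<ge> 2"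
  shows "primitive_episturmian \<sigma>"
  using assms episturmian_nonerasing[OF assms(1)]
  by (simp add: primitive_episturmian_def primitive_nonerasing_def primitive_nonerasing_axioms_def
      primitive_episturmian_axioms_def)

text \<open>The powers of \<open>\<mu> \<circ> \<rho>\<close> are those of \<open>\<rho> \<circ> \<mu>\<close> between a first \<open>\<rho>\<close> and a last \<open>\<mu>\<close>,
  so the factors of \<open>\<mu> \<circ> \<rho>\<close> occur in images under \<open>\<mu>\<close> of factors of \<open>\<rho> \<circ> \<mu>\<close>.  For
  \<open>psi_bar a\<close> these images agree with those under \<open>psi a\<close> up to one letter \<open>a\<close> at either end.\<close>

lemma cyclic_shift:
  fixes \<rho> :: "'a::finite list \<Rightarrow> 'a list"
  assumes \<sigma>: "primitive_episturmian (\<mu> \<circ> \<rho>)"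
    and \<mu>: "\<mu> \<in> {psi a, psi_bar a}" and \<rho>: "\<rho> \<in> episturmian"
  shows "primitive_episturmian (\<rho> \<circ> \<mu>)"
    and "v \<in> iterate_factors (\<mu> \<circ> \<rho>) \<Longrightarrow> \<exists>z\<in>iterate_factors (\<rho> \<circ> \<mu>). sublist v (psi a z)"
proof -
  interpret primitive_episturmian "\<mu> \<circ> \<rho>" by fact
  have \<mu>_epi: "\<mu> \<in> episturmian" using \<mu> by (auto intro: episturmian.intros)
  interpret \<mu>: nonerasing_morphism \<mu> by (rule episturmian_nonerasing[OF \<mu>_epi])
  interpret \<rho>: nonerasing_morphism \<rho> by (rule episturmian_nonerasing[OF \<rho>])
  have pow: "((\<mu> \<circ> \<rho>) ^^ m) (\<mu> u) = \<mu> (((\<rho> \<circ> \<mu>) ^^ m) u)" for m u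
    by (induction m) auto
  have pow': "((\<rho> \<circ> \<mu>) ^^ Suc m) u = \<rho> (((\<mu> \<circ> \<rho>) ^^ m) (\<mu> u))" for m u
    by (simp add: pow)
  show shift: "primitive_episturmian (\<rho> \<circ> \<mu>)"
  proof (rule primitive_episturmianI)
    show "\<rho> \<circ> \<mu> \<in> episturmian" by (rule episturmian.comp[OF \<rho> \<mu>_epi])
    show "CARD('a) \<ge> 2" by (rule two_letters)
    from eventually_all_letters obtain k where k: "\<forall>M\<ge>k. \<forall>c d. d \<in> set (((\<mu> \<circ> \<rho>) ^^ M) [c])" ..
    have "b \<in> set (((\<rho> \<circ> \<mu>) ^^ Suc k) [c])" for b c
    proof -
      obtain x where x: "b \<in> set (\<rho> [x])" using episturmian_letter_occurs[OF \<rho>] by blast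
      have e: "hd (\<mu> [c]) \<in> set (\<mu> [c])" by (rule hd_in_set[OF \<mu>.nonempty])
      have "x \<in> set (((\<mu> \<circ> \<rho>) ^^ k) (\<mu> [c]))"
        using nonerasing_morphism.set_image_mono[OF nonerasing_pow[of k] e] k by blast
      then show ?thesis unfolding pow' using \<rho>.set_image_mono x by blast
    qed
    moreover have "1 \<le> Suc k" by simp
    ultimately show "primitive_morphism (\<rho> \<circ> \<mu>)"
      unfolding primitive_morphism_def by blast
  qed
  interpret shift: primitive_episturmian "\<rho> \<circ> \<mu>" by (rule shift)
  assume "v \<in> iterate_factors (\<mu> \<circ> \<rho>)"
  then obtain m c where v: "sublist v (((\<mu> \<circ> \<rho>) ^^ m) [c])" by (auto simp: iterate_factors_def)
  have "c \<in> set (\<mu> [c])" using \<mu> by (auto simp: psi_simps psi_bar_simps)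
  then have "sublist [c] (\<mu> [c])" by (auto simp: in_set_conv_decomp sublist_def)
  then have "sublist (((\<mu> \<circ> \<rho>) ^^ m) [c]) (((\<mu> \<circ> \<rho>) ^^ m) (\<mu> [c]))"
    by (rule nonerasing_morphism.sublist_image[OF nonerasing_pow])
  then have v\<mu>: "sublist v (\<mu> (((\<rho> \<circ> \<mu>) ^^ m) [c]))"
    using v unfolding pow by (meson sublist_order.order.trans)
  define z where "z = ((\<rho> \<circ> \<mu>) ^^ m) [c]"
  have z: "z \<in> iterate_factors (\<rho> \<circ> \<mu>)" unfolding z_def by (rule iterate_factorsI[of _ m _ c]) simp
  show "\<exists>z\<in>iterate_factors (\<rho> \<circ> \<mu>). sublist v (psi a z)"
  proof (cases "\<mu> = psi a")
    case True
    then show ?thesis using v\<mu> z by (auto simp: z_def)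
  next
    case False
    then have "\<mu> = psi_bar a" using \<mu> by simp
    then have v: "sublist v (psi_bar a z)" using v\<mu> by (simp add: z_def)
    \<comment> \<open>One more letter to the right of \<open>z\<close> supplies the missing last \<open>a\<close>.\<close>
    obtain x y where xy: "length y \<ge> 1" "x @ z @ y \<in> iterate_factors (\<rho> \<circ> \<mu>)"
      using shift.iterate_factors_extend[OF z, of 1] by blast
    then obtain t where t: "psi a y = a # t" using psi_hd[of y a] by fastforce
    have "sublist (z @ y) (x @ (z @ y) @ [])" by (rule sublist_appendI)
    then have "z @ y \<in> iterate_factors (\<rho> \<circ> \<mu>)" using iterate_factors_sublist xy(2) by fastforce
    moreover have "psi a (z @ y) = [a] @ psi_bar a z @ t"
      using psi_conj_psi_bar[of a z] by (simp add: psi_simps t)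
    then have "sublist (psi_bar a z) (psi a (z @ y))" by (metis sublist_appendI)
    ultimately show ?thesis using v by (meson sublist_order.order.trans)
  qed
qed

context primitive_episturmian
begin

lemma not_map: "\<sigma> \<noteq> map \<pi>"
  using image_not_letter by auto

lemma left_special_iff:
  "left_special \<sigma> v \<longleftrightarrow> (\<exists>a b. a \<noteq> b \<and> a # v \<in> iterate_factors \<sigma> \<and> b # v \<in> iterate_factors \<sigma>)"
  unfolding left_special_def language_eq_iterate_factors
  using iterate_factors_sublist sublist_append_leftI[of v "[_]", simplified] by blast

lemma right_special_iff:
  "right_special \<sigma> v \<longleftrightarrow> (\<exists>a b. a \<noteq> b \<and> v @ [a] \<in> iterate_factors \<sigma> \<and> v @ [b] \<in> iterate_factors \<sigma>)"
  unfolding right_special_def language_eq_iterate_factors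
  using iterate_factors_sublist sublist_append_rightI by blast

lemma right_extend: "v \<in> iterate_factors \<sigma> \<Longrightarrow> \<exists>e. v @ [e] \<in> iterate_factors \<sigma>"
proof -
  assume "v \<in> iterate_factors \<sigma>"
  then obtain x y where xy: "length y \<ge> 1" "x @ v @ y \<in> iterate_factors \<sigma>"
    using iterate_factors_extend[of v 1] by blast
  then have y: "y = hd y # tl y" by (cases y) auto
  have "x @ v @ y = x @ (v @ [hd y]) @ tl y" by (subst y) simp
  then have "sublist (v @ [hd y]) (x @ v @ y)" using sublist_appendI by metis
  then show ?thesis using xy(2) iterate_factors_sublist by blast
qed

end

subsection \<open>Uniqueness and existence of left special words\<close>

text \<open>Desubstituting two left special words shortens both of them, so induction on their
  lengths applies to all primitive episturmian morphisms at once.\<close>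

lemma left_special_comparable:
  fixes \<sigma> :: "'a::finite list \<Rightarrow> 'a list"
  assumes "primitive_episturmian \<sigma>" "left_special \<sigma> u" "left_special \<sigma> v"
  shows "prefix u v \<or> prefix v u"
  using assms
proof (induction "length u + length v" arbitrary: \<sigma> u v rule: less_induct)
  case less
  interpret primitive_episturmian \<sigma> by (rule less.prems)
  show ?case
  proof (cases "u = [] \<or> v = []")
    case False
    obtain a \<mu> \<rho> where \<mu>: "\<mu> \<in> {psi a, psi_bar a}" and \<rho>: "\<rho> \<in> episturmian" and \<sigma>: "\<sigma> = \<mu> \<circ> \<rho>"
      using episturmian_first_factor[OF episturmian] not_map by blast
    note shift = cyclic_shift[OF less.prems(1)[unfolded \<sigma>] \<mu> \<rho>]
    interpret shift: primitive_episturmian "\<rho> \<circ> \<mu>" by (rule shift(1))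
    have desubstitute: "\<exists>x'. length x' < length x \<and> prefix x (psi a x' @ [a]) \<and> left_special (\<rho> \<circ> \<mu>) x'"
      if x: "left_special \<sigma> x" "x \<noteq> []" for x
    proof -
      obtain c d where cd: "c \<noteq> d" "c # x \<in> iterate_factors \<sigma>" "d # x \<in> iterate_factors \<sigma>"
        using x(1) left_special_iff by blast
      obtain e e' where e: "c # x @ [e] \<in> iterate_factors \<sigma>" "d # x @ [e'] \<in> iterate_factors \<sigma>"
        using right_extend[OF cd(2)] right_extend[OF cd(3)] by auto
      have F: "\<And>v. v \<in> iterate_factors \<sigma> \<Longrightarrow> \<exists>z\<in>iterate_factors (\<rho> \<circ> \<mu>). sublist v (psi a z)"
        using shift(2) unfolding \<sigma> .
      have "\<exists>x'. length x' < length x \<and> prefix x (psi a x' @ [a]) \<and>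
          c # x' \<in> iterate_factors (\<rho> \<circ> \<mu>) \<and> d # x' \<in> iterate_factors (\<rho> \<circ> \<mu>)"
        by (rule left_special_desubstitute[OF cd(1) x(2) e]) (erule F, erule (1) iterate_factors_sublist)
      then show ?thesis using cd(1) unfolding shift.left_special_iff by blast
    qed
    obtain u' where u': "length u' < length u" "prefix u (psi a u' @ [a])" "left_special (\<rho> \<circ> \<mu>) u'"
      using desubstitute[of u] less.prems(2) False by blast
    obtain v' where v': "length v' < length v" "prefix v (psi a v' @ [a])" "left_special (\<rho> \<circ> \<mu>) v'"
      using desubstitute[of v] less.prems(3) False by blast
    have "prefix u' v' \<or> prefix v' u'"
      using less.hyps[OF _ shift(1) u'(3) v'(3)] u'(1) v'(1) by simp
    then show ?thesis
    proof
      assume "prefix u' v'"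
      then have "prefix u (psi a v' @ [a])" by (rule prefix_order.trans[OF u'(2) psi_prefix_mono])
      then show ?thesis using v'(2) prefix_same_cases by blast
    next
      assume "prefix v' u'"
      then have "prefix v (psi a u' @ [a])" by (rule prefix_order.trans[OF v'(2) psi_prefix_mono])
      then show ?thesis using u'(2) prefix_same_cases by blast
    qed
  qed auto
qed

lemma left_special_unique:
  fixes \<sigma> :: "'a::finite list \<Rightarrow> 'a list"
  assumes "primitive_episturmian \<sigma>" "left_special \<sigma> u" "left_special \<sigma> v" "length u = length v"
  shows "u = v"
  using left_special_comparable[OF assms(1-3)] assms(4) by (auto simp: prefix_def)

context primitive_episturmian
begin

text \<open>\<open>w @ q\<close> is not empty, since otherwise the images of all letters would have length one.\<close>

lemma conjugates:
  obtains w q \<tau> \<theta> where "\<tau> \<in> standard_episturmian"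
    "\<And>u. \<tau> u @ w = w @ \<sigma> u" "\<And>u. \<sigma> u @ q = q @ \<theta> u" "inj \<sigma>" "ind \<sigma> = length w"
    "total_length \<sigma> = (CARD('a) - 1) * length (w @ q) + CARD('a)" "w @ q \<noteq> []"
proof -
  obtain w q \<tau> \<theta> where \<tau>: "\<tau> \<in> standard_episturmian" and \<theta>: "nonerasing_morphism \<theta>"
    and w: "conjugate_by \<tau> w \<sigma>" and q: "conjugate_by \<sigma> q \<theta>"
    and count: "\<forall>c. (\<Sum>x\<in>UNIV. count_list (\<sigma> [x]) c) = (CARD('a) - 1) * count_list (w @ q) c + 1"
    using episturmian_conjugates[OF episturmian] by blast
  note total = total_length_conjugates[OF count]
  have "w @ q \<noteq> []"
  proof
    assume "w @ q = []"
    then have "(\<Sum>x\<in>UNIV. length (\<sigma> [x])) = (\<Sum>x\<in>(UNIV :: 'a set). 1)"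
      using total by (simp add: total_length_def)
    moreover have ge1: "length (\<sigma> [x]) \<ge> 1" for x using nonempty[of x] by (simp add: Suc_leI)
    ultimately have "length (\<sigma> [x]) = 1" for x
      using sum_strict_mono_ex1[of UNIV "\<lambda>_. 1" "\<lambda>x. length (\<sigma> [x])"]
      by (metis UNIV_I finite le_neq_implies_less less_irrefl)
    then show False using image_not_letter by blast
  qed
  with that[of \<tau> w q \<theta>] show ?thesis
    using \<tau> total conjugate_inj[OF \<tau> nonerasing_morphism_axioms w]
      ind_eq_length[OF two_letters nonerasing_morphism_axioms \<tau> w]
      conjugate_by_words[OF standard_nonerasing[OF \<tau>] nonerasing_morphism_axioms w]
      conjugate_by_words[OF nonerasing_morphism_axioms \<theta> q] by blast
qed

text \<open>If every letter extends \<open>v\<close> to the left, then also \<open>w @ \<sigma> v @ q\<close>: every occurrence of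
  \<open>\<sigma> v\<close> coming from \<open>v\<close> is surrounded by \<open>w\<close> and \<open>q\<close>, and the letters in front of them
  are the last letters of the words \<open>\<tau> [c]\<close>, that is all letters.\<close>

lemma long_left_special: "\<exists>v. length v \<ge> n \<and> (\<forall>c. c # v \<in> iterate_factors \<sigma>)"
proof (induction n)
  case 0
  show ?case by (intro exI[of _ "[]"]) (simp add: iterate_factors_letter)
next
  case (Suc n)
  then obtain v where v: "length v \<ge> n" "\<And>c. c # v \<in> iterate_factors \<sigma>" by blast
  obtain w q \<tau> \<theta> where \<tau>: "\<tau> \<in> standard_episturmian"
    and w: "\<And>u. \<tau> u @ w = w @ \<sigma> u" and q: "\<And>u. \<sigma> u @ q = q @ \<theta> u" and wq: "w @ q \<noteq> []"
    by (rule conjugates) blast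
  obtain \<pi> where \<pi>: "bij \<pi>" "\<And>u. u \<noteq> [] \<Longrightarrow> last (\<tau> u) = \<pi> (last u)"
    using standard_last_letter[OF \<tau>] by blast
  have "d # w @ \<sigma> v @ q \<in> iterate_factors \<sigma>" for d
  proof -
    obtain c where c: "\<pi> c = d" using \<pi>(1) by (metis bij_pointE)
    have "\<tau> [c] \<noteq> []" by (rule nonerasing_morphism.nonempty[OF standard_nonerasing[OF \<tau>]])
    then obtain t where t: "\<tau> [c] = t @ [d]" using \<pi>(2)[of "[c]"] c append_butlast_last_id
      by (metis last.simps list.distinct(1))
    \<comment> \<open>The context must be so long that \<open>\<sigma> x\<close> ends with \<open>w\<close> and \<open>\<sigma> y\<close> begins with \<open>q\<close>.\<close>
    obtain x y where xy: "length x \<ge> length (w @ q)" "length y \<ge> length (w @ q)"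
      and F: "x @ (c # v) @ y \<in> iterate_factors \<sigma>"
      using iterate_factors_extend[OF v(2)] by blast
    obtain x' where x': "\<sigma> x = x' @ w"
      using longer_suffix[OF w[of x, symmetric]] length_le[of x] xy(1) by auto
    obtain y' where y': "\<sigma> y = q @ y'"
      using longer_prefix[OF q[of y]] length_le[of y] xy(2) by auto
    have "x @ (c # v) @ y = x @ [c] @ v @ y" by simp
    then have "\<sigma> (x @ (c # v) @ y) = \<sigma> x @ \<sigma> [c] @ \<sigma> v @ \<sigma> y" by (simp only: append)
    also have "\<dots> = x' @ (w @ \<sigma> [c]) @ \<sigma> v @ q @ y'" by (simp add: x' y')
    also have "\<dots> = (x' @ t) @ (d # w @ \<sigma> v @ q) @ y'" by (simp add: w[symmetric] t)
    finally have "sublist (d # w @ \<sigma> v @ q) (\<sigma> (x @ (c # v) @ y))" by (metis sublist_appendI)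
    then show ?thesis using image_iterate_factors[OF F] iterate_factors_sublist by blast
  qed
  moreover have "length (w @ \<sigma> v @ q) \<ge> Suc n"
  proof -
    have "length (w @ q) \<ge> 1" using wq by (cases "w @ q") auto
    then show ?thesis using v(1) length_le[of v] by simp
  qed
  ultimately show ?case by blast
qed

lemma left_special_exists: "\<exists>v. left_special \<sigma> v \<and> length v = n"
proof -
  obtain v where v: "length v \<ge> n" "\<And>c. c # v \<in> iterate_factors \<sigma>" using long_left_special by blast
  have "sublist (c # take n v) (c # v)" for c
    by (metis append_Cons append_take_drop_id prefixI prefix_imp_sublist)
  then have "c # take n v \<in> iterate_factors \<sigma>" for c using v(2) iterate_factors_sublist by blast
  then have "left_special \<sigma> (take n v)" unfolding left_special_iff using other_letter by blast
  then show ?thesis using v(1) by (intro exI[of _ "take n v"]) simp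
qed

lemma left_special_word: "left_special \<sigma> (left_special_word \<sigma> n) \<and> length (left_special_word \<sigma> n) = n"
  unfolding left_special_word_def
proof (rule theI')
  show "\<exists>!v. left_special \<sigma> v \<and> length v = n"
  proof (rule ex_ex1I)
    fix u v assume "left_special \<sigma> u \<and> length u = n" "left_special \<sigma> v \<and> length v = n"
    then show "u = v"
      using left_special_unique[OF primitive_episturmian_axioms] by blast
  qed (rule left_special_exists)
qed

end

subsection \<open>Right special words by reversal\<close>

definition mirror :: "('a list \<Rightarrow> 'a list) \<Rightarrow> 'a list \<Rightarrow> 'a list" where
  "mirror \<sigma> = rev \<circ> \<sigma> \<circ> rev"

lemma mirror_psi: "mirror (psi a) = psi_bar a" and mirror_psi_bar: "mirror (psi_bar a) = psi a"
proof -
  have "rev (psi a (rev u)) = psi_bar a u" "rev (psi_bar a (rev u)) = psi a u" for u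
    by (induction u) (simp_all add: psi_simps psi_bar_simps)
  then show "mirror (psi a) = psi_bar a" "mirror (psi_bar a) = psi a" by (auto simp: mirror_def)
qed

lemma mirror_episturmian: "\<sigma> \<in> episturmian \<Longrightarrow> mirror \<sigma> \<in> episturmian"
proof (induction rule: episturmian.induct)
  case id
  have "mirror id = (id :: 'a list \<Rightarrow> _)" by (auto simp: mirror_def)
  then show ?case by (simp only: episturmian.id)
next
  case (perm \<pi>)
  have "mirror (map \<pi>) = map \<pi>" by (auto simp: mirror_def rev_map)
  then show ?case using perm by (simp only: episturmian.perm)
next
  case (comp \<sigma> \<tau>)
  have "mirror (\<sigma> \<circ> \<tau>) = mirror \<sigma> \<circ> mirror \<tau>" by (auto simp: mirror_def)
  then show ?case using comp by (simp only: episturmian.comp)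
qed (simp_all only: mirror_psi mirror_psi_bar episturmian.psi episturmian.psi_bar)

lemma mirror_pow: "(mirror \<sigma> ^^ m) u = rev ((\<sigma> ^^ m) (rev u))"
  by (induction m) (auto simp: mirror_def)

lemma mirror_iterate_factors: "v \<in> iterate_factors (mirror \<sigma>) \<longleftrightarrow> rev v \<in> iterate_factors \<sigma>"
proof -
  have "sublist v (rev u) \<longleftrightarrow> sublist (rev v) u" for v u :: "'a list"
    by (metis rev_rev_ident sublist_rev)
  then show ?thesis by (simp add: iterate_factors_def mirror_pow)
qed

context primitive_episturmian
begin

lemma mirror_primitive_episturmian: "primitive_episturmian (mirror \<sigma>)"
proof (rule primitive_episturmianI)
  show "primitive_morphism (mirror \<sigma>)"
    using primitive by (simp add: primitive_morphism_def mirror_pow)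
qed (simp_all add: mirror_episturmian episturmian two_letters)

lemma right_special_mirror: "right_special \<sigma> v \<longleftrightarrow> left_special (mirror \<sigma>) (rev v)"
  unfolding right_special_iff primitive_episturmian.left_special_iff[OF mirror_primitive_episturmian]
  by (simp add: mirror_iterate_factors)

lemma right_special_word: "right_special \<sigma> (right_special_word \<sigma> n) \<and> length (right_special_word \<sigma> n) = n"
proof -
  interpret mirror: primitive_episturmian "mirror \<sigma>" by (rule mirror_primitive_episturmian)
  have "right_special \<sigma> (rev (left_special_word (mirror \<sigma>) n))"
    using mirror.left_special_word[of n] by (simp add: right_special_mirror)
  moreover have "v = rev (left_special_word (mirror \<sigma>) n)" if "right_special \<sigma> v" "length v = n" for v
  proof -
    have "rev v = left_special_word (mirror \<sigma>) n"
      using left_special_unique[OF mirror_primitive_episturmian] that mirror.left_special_word[of n]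
      by (simp add: right_special_mirror)
    then show ?thesis by (metis rev_rev_ident)
  qed
  moreover have "length (rev (left_special_word (mirror \<sigma>) n)) = n"
    using mirror.left_special_word[of n] by simp
  ultimately have "right_special_word \<sigma> n = rev (left_special_word (mirror \<sigma>) n)"
    unfolding right_special_word_def by (intro the_equality conjI) blast+
  then show ?thesis
    using mirror.left_special_word[of n] by (simp add: right_special_mirror)
qed

end

section \<open>Return words\<close>

lemma return_set_iff:
  "r \<in> return_set \<sigma> u \<longleftrightarrow> r @ u \<in> language \<sigma> \<and> r \<noteq> [] \<and> prefix u (r @ u) \<and>
    \<not> (\<exists>p s. p \<noteq> [] \<and> s \<noteq> [] \<and> r @ u = p @ u @ s)"
proof -
  have "(\<exists>s. r @ u = u @ s \<and> s \<noteq> []) \<longleftrightarrow> r \<noteq> [] \<and> prefix u (r @ u)"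
    by (auto simp: prefix_def)
  then show ?thesis by (auto simp: return_set_def)
qed

context primitive_episturmian
begin

text \<open>A word that leads from one occurrence of \<open>u\<close> to another is cut at an occurrence in between, as long
  as there is one.\<close>

lemma concat_return_words:
  assumes "z @ u \<in> language \<sigma>" "prefix u (z @ u)"
  shows "\<exists>rs. set rs \<subseteq> return_set \<sigma> u \<and> z = concat rs"
  using assms
proof (induction "length z" arbitrary: z rule: less_induct)
  case less
  show ?case
  proof (cases "z = [] \<or> z \<in> return_set \<sigma> u")
    case True
    then show ?thesis
    proof
      assume "z \<in> return_set \<sigma> u"
      then show ?thesis by (intro exI[of _ "[z]"]) simp
    qed (intro exI[of _ "[]"], simp)
  next
    case False
    then obtain p s where ps: "p \<noteq> []" "s \<noteq> []" "z @ u = p @ u @ s"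
      using less.prems unfolding return_set_iff by blast
    have "length z = length p + length s" using arg_cong[OF ps(3), of length] by simp
    moreover obtain z' where z': "z = p @ z'" "z' @ u = u @ s"
      using longer_prefix[OF ps(3)] ps(3) calculation by auto
    ultimately have len: "length p < length z" "length z' < length z"
      using ps(1,2) by (auto simp flip: length_greater_0_conv)
    have "prefix (p @ u) (z @ u)" "sublist (z' @ u) (z @ u)" using ps(3) z' by auto
    then have lang: "p @ u \<in> language \<sigma>" "z' @ u \<in> language \<sigma>"
      using less.prems(1) iterate_factors_sublist prefix_imp_sublist
      unfolding language_eq_iterate_factors by blast+
    have "prefix u (p @ u)"
      using prefix_length_prefix[OF less.prems(2) \<open>prefix (p @ u) (z @ u)\<close>] by simp
    moreover have "prefix u (z' @ u)" using z'(2) by simp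
    ultimately obtain rs rs' where "set rs \<subseteq> return_set \<sigma> u" "p = concat rs"
      "set rs' \<subseteq> return_set \<sigma> u" "z' = concat rs'"
      using less.hyps[OF len(1) lang(1)] less.hyps[OF len(2) lang(2)] by blast
    then show ?thesis using z'(1) by (intro exI[of _ "rs @ rs'"]) simp
  qed
qed

text \<open>If \<open>\<sigma>\<close> maps the return words of \<open>u\<close> onto those of \<open>\<sigma> u\<close>, then every word leading from
  one occurrence of \<open>\<sigma> u\<close> to another, being a product of return words, lifts to \<open>u\<close>.\<close>

lemma return_preserving_lift:
  assumes pres: "return_preserving \<sigma> u"
    and z: "z @ \<sigma> u \<in> language \<sigma>" "prefix (\<sigma> u) (z @ \<sigma> u)"
  shows "\<exists>r. z = \<sigma> r \<and> prefix u (r @ u)"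
proof -
  obtain rs where "set rs \<subseteq> return_set \<sigma> (\<sigma> u)" "z = concat rs"
    using concat_return_words[OF z] by blast
  then have rs: "set rs \<subseteq> \<sigma> ` return_set \<sigma> u" using pres by (simp add: return_preserving_def)
  have "\<exists>r. concat rs = \<sigma> r \<and> prefix u (r @ u)"
    using rs
  proof (induction rs)
    case Nil
    show ?case by (intro exI[of _ "[]"]) (simp add: image_Nil)
  next
    case (Cons x rs)
    then obtain r r1 where r: "concat rs = \<sigma> r" "prefix u (r @ u)"
      and r1: "x = \<sigma> r1" "r1 \<in> return_set \<sigma> u" by auto
    have "prefix u (r1 @ u)" using r1(2) by (simp add: return_set_iff)
    then have "prefix u (r1 @ r @ u)" using r(2) by (meson prefix_order.trans same_prefix_prefix)
    then show ?case using r(1) r1(1) by (intro exI[of _ "r1 @ r"]) (simp add: append)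
  qed
  then show ?thesis using \<open>z = concat rs\<close> by simp
qed

text \<open>Here \<open>w = w1 @ \<sigma> [a]\<close>, and \<open>v = B @ t @ [b]\<close> with \<open>b \<noteq> a\<close> leads from one occurrence of \<open>B\<close> to
  another.  Images of long words end with \<open>w\<close>, so that \<open>\<sigma> (a # B)\<close> occurs around both ends of
  \<open>\<sigma> v\<close>, although the second occurrence of \<open>B\<close> is preceded by \<open>b\<close>.\<close>

theorem not_return_preserving_left:
  assumes B: "left_special \<sigma> B" and ind: "length (\<sigma> [a]) \<le> ind \<sigma>"
  shows "\<not> return_preserving \<sigma> (a # B)"
proof
  assume pres: "return_preserving \<sigma> (a # B)"
  obtain b where b: "b \<noteq> a" "b # B \<in> iterate_factors \<sigma>" using B unfolding left_special_iff by metis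
  obtain w q \<tau> \<theta> where w: "\<And>u. \<tau> u @ w = w @ \<sigma> u" and inj: "inj \<sigma>" and len_w: "ind \<sigma> = length w"
    by (rule conjugates) blast
  obtain w1 where w1: "w = w1 @ \<sigma> [a]"
    using longer_suffix[OF w[of "[a]"]] ind len_w by auto
  have "B \<in> iterate_factors \<sigma>" using B by (simp add: left_special_def language_eq_iterate_factors)
  then obtain x t y where x: "length x \<ge> length w" and F: "x @ B @ t @ (b # B) @ y \<in> iterate_factors \<sigma>"
    using iterate_factors_connect b(2) by blast
  define v where "v = B @ t @ [b]"
  have vB: "v @ B = B @ t @ [b] @ B" by (simp add: v_def)
  obtain x' where x': "\<sigma> x = x' @ w"
    using longer_suffix[OF w[of x, symmetric]] length_le[of x] x by auto
  have "\<sigma> (x @ (v @ B) @ y) \<in> iterate_factors \<sigma>" using image_iterate_factors[OF F] by (simp add: vB)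
  then have "(x' @ w1) @ (\<sigma> [a] @ \<sigma> v @ \<sigma> B) @ \<sigma> y \<in> iterate_factors \<sigma>"
    by (simp only: append append_assoc x' w1)
  then have X: "\<sigma> [a] @ \<sigma> v @ \<sigma> B \<in> language \<sigma>"
    unfolding language_eq_iterate_factors by (rule iterate_factors_sublist) (rule sublist_appendI)
  \<comment> \<open>\<open>w1 @ \<sigma> [a] @ \<sigma> v\<close> is \<open>w @ \<sigma> v = \<tau> v @ w\<close>, so \<open>\<sigma> [a] @ \<sigma> v\<close> ends with \<open>\<sigma> [a]\<close>.\<close>
  have "w1 @ (\<sigma> [a] @ \<sigma> v) = (\<tau> v @ w1) @ \<sigma> [a]" using w[of v] by (simp add: w1)
  from longer_suffix[OF this] obtain z where z: "\<sigma> [a] @ \<sigma> v = z @ \<sigma> [a]" by auto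
  have \<sigma>aB: "\<sigma> (a # B) = \<sigma> [a] @ \<sigma> B" by (rule image_Cons)
  have X_eq: "z @ \<sigma> (a # B) = \<sigma> [a] @ \<sigma> v @ \<sigma> B" using z by (simp add: \<sigma>aB flip: append_assoc)
  have "\<sigma> [a] @ \<sigma> v @ \<sigma> B = \<sigma> (a # B) @ \<sigma> (t @ [b] @ B)"
    using append[of v B] append[of B "t @ [b] @ B"] by (simp add: \<sigma>aB vB)
  then have "prefix (\<sigma> (a # B)) (z @ \<sigma> (a # B))" unfolding X_eq by simp
  then obtain r where r: "z = \<sigma> r" using return_preserving_lift[OF pres, of z] X unfolding X_eq by blast
  have "\<sigma> (r @ [a]) = \<sigma> (a # v)" using z by (simp add: append[of r] image_Cons[of a v] r)
  then have "r @ [a] = a # B @ t @ [b]" using inj by (simp add: inj_eq v_def)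
  then have "last (r @ [a]) = last (a # B @ t @ [b])" by (rule arg_cong)
  then show False using b(1) by simp
qed

text \<open>The inequality says that \<open>\<sigma> [a]\<close> is not longer than \<open>q\<close>, since the lengths of \<open>w\<close> and \<open>q\<close> add
  up to the quotient of \<open>total_length \<sigma> - CARD('a)\<close> by \<open>CARD('a) - 1\<close>.  Here \<open>\<sigma> [a]\<close> follows every
  image of \<open>B\<close> because the image of a long word begins with \<open>q\<close>.\<close>

theorem not_return_preserving_right:
  assumes B: "right_special \<sigma> B"
    and ind: "(CARD('a) - 1) * (ind \<sigma> + length (\<sigma> [a])) + CARD('a) \<le> total_length \<sigma>"
  shows "\<not> return_preserving \<sigma> (B @ [a])"
proof
  assume pres: "return_preserving \<sigma> (B @ [a])"
  obtain b where b: "b \<noteq> a" "B @ [b] \<in> iterate_factors \<sigma>" using B unfolding right_special_iff by metis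
  obtain w q \<tau> \<theta> where q: "\<And>u. \<sigma> u @ q = q @ \<theta> u" and inj: "inj \<sigma>" and len_w: "ind \<sigma> = length w"
    and total: "total_length \<sigma> = (CARD('a) - 1) * length (w @ q) + CARD('a)"
    by (rule conjugates) blast
  have "length (\<sigma> [a]) \<le> length q" using ind two_letters by (simp add: total len_w)
  then obtain q1 where q1: "q = \<sigma> [a] @ q1"
    using longer_prefix[OF q[of "[a]", symmetric]] by auto
  have "B \<in> iterate_factors \<sigma>" using B by (simp add: right_special_def language_eq_iterate_factors)
  then obtain x t y where y: "length y \<ge> length q" and F: "x @ (B @ [b]) @ t @ B @ y \<in> iterate_factors \<sigma>"
    using iterate_factors_connect b(2) by blast
  define v where "v = [b] @ t @ B"
  obtain y' where y': "\<sigma> y = q @ y'"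
    using longer_prefix[OF q[of y]] length_le[of y] y by auto
  have "\<sigma> (x @ B @ v @ y) \<in> iterate_factors \<sigma>" using image_iterate_factors[OF F] by (simp add: v_def)
  then have "\<sigma> x @ (\<sigma> B @ \<sigma> v @ \<sigma> [a]) @ (q1 @ y') \<in> iterate_factors \<sigma>"
    by (simp only: append append_assoc y' q1)
  then have X: "\<sigma> B @ \<sigma> v @ \<sigma> [a] \<in> language \<sigma>"
    unfolding language_eq_iterate_factors by (rule iterate_factors_sublist) (rule sublist_appendI)
  \<comment> \<open>\<open>\<sigma> v @ q\<close> begins with \<open>q\<close>, so \<open>\<sigma> v @ \<sigma> [a]\<close> begins with \<open>\<sigma> [a]\<close>.\<close>
  have "(\<sigma> v @ \<sigma> [a]) @ q1 = \<sigma> [a] @ (q1 @ \<theta> v)" using q[of v] by (simp add: q1)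
  from longer_prefix[OF this] obtain s where s: "\<sigma> v @ \<sigma> [a] = \<sigma> [a] @ s" by auto
  let ?z = "\<sigma> (B @ [b] @ t)"
  have \<sigma>Ba: "\<sigma> (B @ [a]) = \<sigma> B @ \<sigma> [a]" by (rule append)
  have X_eq: "?z @ \<sigma> (B @ [a]) = \<sigma> B @ \<sigma> v @ \<sigma> [a]"
    using append[of "B @ [b] @ t" B] append[of B v] by (simp add: \<sigma>Ba v_def)
  have "prefix (\<sigma> (B @ [a])) (?z @ \<sigma> (B @ [a]))" unfolding X_eq s by (simp add: \<sigma>Ba)
  then obtain r where r: "?z = \<sigma> r" "prefix (B @ [a]) (r @ B @ [a])"
    using return_preserving_lift[OF pres, of ?z] X unfolding X_eq by blast
  have "r = B @ [b] @ t" using r(1) inj by (simp add: inj_eq)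
  then show False using r(2) b(1) by simp
qed

end

theorem theorem1p1:
  fixes \<sigma> :: "'a::finite list \<Rightarrow> 'a list"
  assumes "CARD('a) \<ge> 2"
    and "\<sigma> \<in> episturmian"
    and "primitive_morphism \<sigma>"
  shows "\<exists>a_min. minimal_letter \<sigma> a_min \<and>
    (ind \<sigma> \<ge> length (\<sigma> [a_min]) \<longrightarrow>
      finite {u \<in> {a_min # left_special_word \<sigma> n | n. left_special_word \<sigma> n = right_special_word \<sigma> n}.
        return_preserving \<sigma> u}) \<and>
    (real (ind \<sigma>) \<le> (real (total_length \<sigma>) - real CARD('a)) / (real CARD('a) - 1)
        - real (length (\<sigma> [a_min])) \<longrightarrow>
      finite {u \<in> {right_special_word \<sigma> n @ [a_min] | n. left_special_word \<sigma> n = right_special_word \<sigma> n}.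
        return_preserving \<sigma> u})"
proof -
  interpret primitive_episturmian \<sigma> using assms by (rule_tac primitive_episturmianI)
  obtain a where a: "minimal_letter \<sigma> a"
    using minimal_letter_exists[OF assms(2,3,1)] by blast
  show ?thesis
  proof (intro exI[of _ a] conjI impI)
    show "minimal_letter \<sigma> a" by (rule a)
  next
    assume "length (\<sigma> [a]) \<le> ind \<sigma>"
    then have "\<not> return_preserving \<sigma> (a # left_special_word \<sigma> n)" for n
      using not_return_preserving_left left_special_word by blast
    then have "{u \<in> {a # left_special_word \<sigma> n | n. left_special_word \<sigma> n = right_special_word \<sigma> n}.
        return_preserving \<sigma> u} = {}" by blast
    then show "finite {u \<in> {a # left_special_word \<sigma> n | n. left_special_word \<sigma> n = right_special_word \<sigma> n}.
        return_preserving \<sigma> u}" by (simp only: finite.emptyI)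
  next
    assume le: "real (ind \<sigma>) \<le> (real (total_length \<sigma>) - real CARD('a)) / (real CARD('a) - 1)
        - real (length (\<sigma> [a]))"
    have "real CARD('a) - 1 > 0" using assms(1) by linarith
    then have "(real CARD('a) - 1) * (real (ind \<sigma>) + real (length (\<sigma> [a]))) + real CARD('a)
        \<le> real (total_length \<sigma>)"
      using le by (simp add: field_simps)
    moreover have "real CARD('a) - 1 = real (CARD('a) - 1)" using assms(1) by (simp add: of_nat_diff)
    ultimately have "(CARD('a) - 1) * (ind \<sigma> + length (\<sigma> [a])) + CARD('a) \<le> total_length \<sigma>"
      by (metis of_nat_add of_nat_le_iff of_nat_mult)
    then have "\<not> return_preserving \<sigma> (right_special_word \<sigma> n @ [a])" for n
      using not_return_preserving_right right_special_word by blast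
    then have "{u \<in> {right_special_word \<sigma> n @ [a] | n. left_special_word \<sigma> n = right_special_word \<sigma> n}.
        return_preserving \<sigma> u} = {}" by blast
    then show "finite {u \<in> {right_special_word \<sigma> n @ [a] | n. left_special_word \<sigma> n = right_special_word \<sigma> n}.
        return_preserving \<sigma> u}" by (simp only: finite.emptyI)
  qed
qed

end
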